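(* All harmonic oscillator Lie bialgebras with generators $\{D,P,K,M\}$ are Schrödinger Lie sub-bialgebras: for every Lie bialgebra structure $\delta_{h_4}$ on the subalgebra $h_4=\mathrm{span}\{D,P,K,M\}$ of the Schrödinger algebra $\mathcal S$ there is a Lie bialgebra structure $\delta$ on $\mathcal S$ with $\delta|_{h_4}=\delta_{h_4}$. The resulting Schrödinger Lie bialgebras containing $h_4$ as a Lie sub-bialgebra are the coboundary ones given by the following classical $r$-matrix and cocommutators, depending on six real parameters $\alpha_+,\alpha_-,\beta_+,\beta_-,\vartheta,\xi$ subject to $$\alpha_+\alpha_-=0,\qquad \alpha_+(\xi+\vartheta)=0,\qquad \alpha_-(\xi-\vartheta)=0:$$ $$r=-\alpha_+D\wedge P-\alpha_-D\wedge K+\beta_+P\wedge M+\beta_-K\wedge M-\vartheta D\wedge M+\xi P\wedge K,$$ $\delta(D)=\alpha_+D\wedge P-\alpha_-D\wedge K-\beta_+P\wedge M+\beta_-K\wedge M$, $\delta(P)=\alpha_-(D\wedge M-P\wedge K)-(\vartheta+\xi)P\wedge M$, $\delta(K)=-\alpha_+(D\wedge M+P\wedge K)+(\vartheta-\xi)K\wedge M$, $\delta(M)=0$, $\delta(H)=2\alpha_+P\wedge H+\alpha_-(D\wedge P+2K\wedge H)-\beta_-P\wedge M-2\vartheta H\wedge M$, $\delta(C)=-2\alpha_-K\wedge C-\alpha_+(D\wedge K+2P\wedge C)+\beta_+K\wedge M+2\vartheta C\wedge M$. The Schouten bracket is $[[r,r]]=(\alpha_+\beta_-+\alpha_-\beta_+-\xi^2)\,K\wedge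 M\wedge P$.
   Context: $\mathcal S$ is the real 6-dimensional Lie algebra with basis $\{D,H,P,K,C,M\}$ and brackets $[D,P]=-P$, $[D,K]=K$, $[K,P]=M$, $[D,H]=-2H$, $[D,C]=2C$, $[H,C]=D$, $[K,H]=P$, $[K,C]=0$, $[P,C]=-K$, $[P,H]=0$, $[M,\cdot]=0$. The span of $D,P,K,M$ is the harmonic oscillator algebra $h_4$ (with $N=-D$, $A_+=P$, $A_-=K$: $[N,A_+]=A_+$, $[N,A_-]=-A_-$, $[A_-,A_+]=M$, $M$ central). A Lie bialgebra $(g,\delta)$ is a Lie algebra $g$ with a linear map $\delta:g\to g\otimes g$ which is a 1-cocycle, $\delta([X,Y])=[\delta(X),1\otimes Y+Y\otimes1]+[1\otimes X+X\otimes 1,\delta(Y)]$, and whose dual $\delta^*:g^*\otimes g^*\to g^*$ is a Lie bracket. It is coboundary with $r$-matrix $r$ (skew-symmetric in $g\otimes g$) if $\delta(X)=[1\otimes X+X\otimes1,r]$ for all $X$. For Lie bialgebras $(h,\delta_h)$, $(g,\delta_g)$ with $h\subset g$ a Lie subalgebra, $h$ is a Lie sub-bialgebra of $g$ if $\delta_g(X)\in h\wedge h$ for all $X\in h$ (and $\delta_g|_h=\delta_h$). Convention: $X\wedge Y=X\otimes Y-Y\otimes X$, $X\wedge Y\wedge Z$ is the signed sum over all six permutations. Schouten bracket: $[[r,r]]=[r_{12},r_{13}]+[r_{12},r_{23}]+[r_{13},r_{23}]$. *)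

theory Defs
  imports "HOL-Analysis.Analysis"
begin

section \<open>Lie algebras on subspaces\<close>

definition linear_on :: "'a::real_vector set \<Rightarrow> ('a \<Rightarrow> 'b::real_vector) \<Rightarrow> bool" where
  "linear_on V f \<longleftrightarrow>
     (\<forall>x\<in>V. \<forall>y\<in>V. f (x + y) = f x + f y) \<and> (\<forall>c. \<forall>x\<in>V. f (c *\<^sub>R x) = c *\<^sub>R f x)"

definition lie_algebra_on :: "'a::real_vector set \<Rightarrow> ('a \<Rightarrow> 'a \<Rightarrow> 'a) \<Rightarrow> bool" where
  "lie_algebra_on V br \<longleftrightarrow>
     subspace V \<and>
     (\<forall>x\<in>V. \<forall>y\<in>V. br x y \<in> V) \<and>
     (\<forall>x\<in>V. linear_on V (\<lambda>y. br x y) \<and> linear_on V (\<lambda>y. br y x)) \<and>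
     (\<forall>x\<in>V. br x x = 0) \<and>
     (\<forall>x\<in>V. \<forall>y\<in>V. \<forall>z\<in>V. br x (br y z) + br y (br z x) + br z (br x y) = 0)"


section \<open>Tensors\<close>

text \<open>The tensor powers of \<open>real ^ 'n\<close> are given by coordinates with respect to the
  standard basis, \<open>t $ i $ j\<close> being the coefficient of \<open>e\<^sub>i \<otimes> e\<^sub>j\<close>.\<close>

definition tensor :: "real ^ 'n \<Rightarrow> real ^ 'n \<Rightarrow> real ^ 'n ^ 'n" (infixl \<open>\<otimes>\<close> 76) where
  "x \<otimes> y = (\<chi> i j. x $ i * y $ j)"

definition tensor3 :: "real ^ 'n \<Rightarrow> real ^ 'n \<Rightarrow> real ^ 'n \<Rightarrow> real ^ 'n ^ 'n ^ 'n" where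
  "tensor3 x y z = (\<chi> i j k. x $ i * y $ j * z $ k)"

definition wedge :: "real ^ 'n \<Rightarrow> real ^ 'n \<Rightarrow> real ^ 'n ^ 'n" (infixl \<open>\<^bold>\<and>\<close> 76) where
  "x \<^bold>\<and> y = x \<otimes> y - y \<otimes> x"

definition wedge3 :: "real ^ 'n \<Rightarrow> real ^ 'n \<Rightarrow> real ^ 'n \<Rightarrow> real ^ 'n ^ 'n ^ 'n" where
  "wedge3 x y z =
     tensor3 x y z + tensor3 y z x + tensor3 z x y
     - tensor3 y x z - tensor3 x z y - tensor3 z y x"

definition tensor_square :: "(real ^ 'n) set \<Rightarrow> (real ^ 'n ^ 'n) set" where
  "tensor_square V = span {x \<otimes> y | x y. x \<in> V \<and> y \<in> V}"

definition wedge_square :: "(real ^ 'n) set \<Rightarrow> (real ^ 'n ^ 'n) set" where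
  "wedge_square V = span {x \<^bold>\<and> y | x y. x \<in> V \<and> y \<in> V}"

text \<open>The commutators \<open>[1 \<otimes> X + X \<otimes> 1, t]\<close> and \<open>[t, 1 \<otimes> Y + Y \<otimes> 1]\<close>.\<close>

definition comm_left ::
  "(real ^ 'n \<Rightarrow> real ^ 'n \<Rightarrow> real ^ 'n) \<Rightarrow> real ^ 'n \<Rightarrow> real ^ 'n ^ 'n \<Rightarrow> real ^ 'n ^ 'n" where
  "comm_left br X t =
     (\<Sum>i\<in>UNIV. \<Sum>j\<in>UNIV.
        t $ i $ j *\<^sub>R (axis i 1 \<otimes> br X (axis j 1) + br X (axis i 1) \<otimes> axis j 1))"

definition comm_right ::
  "(real ^ 'n \<Rightarrow> real ^ 'n \<Rightarrow> real ^ 'n) \<Rightarrow> real ^ 'n ^ 'n \<Rightarrow> real ^ 'n \<Rightarrow> real ^ 'n ^ 'n" where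
  "comm_right br t Y =
     (\<Sum>i\<in>UNIV. \<Sum>j\<in>UNIV.
        t $ i $ j *\<^sub>R (axis i 1 \<otimes> br (axis j 1) Y + br (axis i 1) Y \<otimes> axis j 1))"

text \<open>The Schouten bracket: for \<open>r = (\<Sum>i j. r\<^sub>i\<^sub>j e\<^sub>i \<otimes> e\<^sub>j)\<close> the three summands below are
  the contributions of \<open>r\<^sub>i\<^sub>j r\<^sub>k\<^sub>l\<close> to \<open>[r\<^sub>1\<^sub>2, r\<^sub>1\<^sub>3]\<close>, \<open>[r\<^sub>1\<^sub>2, r\<^sub>2\<^sub>3]\<close> and \<open>[r\<^sub>1\<^sub>3, r\<^sub>2\<^sub>3]\<close>.\<close>

definition schouten ::
  "(real ^ 'n \<Rightarrow> real ^ 'n \<Rightarrow> real ^ 'n) \<Rightarrow> real ^ 'n ^ 'n \<Rightarrow> real ^ 'n ^ 'n ^ 'n" where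
  "schouten br r =
     (\<Sum>i\<in>UNIV. \<Sum>j\<in>UNIV. \<Sum>k\<in>UNIV. \<Sum>l\<in>UNIV. (r $ i $ j * r $ k $ l) *\<^sub>R
        (tensor3 (br (axis i 1) (axis k 1)) (axis j 1) (axis l 1)
         + tensor3 (axis i 1) (br (axis j 1) (axis k 1)) (axis l 1)
         + tensor3 (axis i 1) (axis k 1) (br (axis j 1) (axis l 1))))"


section \<open>Lie bialgebras\<close>

text \<open>\<open>(f \<otimes> g)(t)\<close> for linear functionals \<open>f\<close>, \<open>g\<close>. For \<open>t \<in> V \<otimes> V\<close> this depends only on
  the restrictions of \<open>f\<close> and \<open>g\<close> to \<open>V\<close>.\<close>

definition tensor_pairing ::
  "((real ^ 'n) \<Rightarrow>\<^sub>L real) \<Rightarrow> ((real ^ 'n) \<Rightarrow>\<^sub>L real) \<Rightarrow> real ^ 'n ^ 'n \<Rightarrow> real" where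
  "tensor_pairing f g t =
     (\<Sum>i\<in>UNIV. \<Sum>j\<in>UNIV. t $ i $ j * (blinfun_apply f (axis i 1) * blinfun_apply g (axis j 1)))"

text \<open>The dual of a subspace \<open>V\<close>: restriction to \<open>V\<close> is a linear isomorphism from the
  functionals vanishing on the complement \<open>V\<^sup>\<bottom>\<close> onto the space of linear functionals on \<open>V\<close>.
  The choice of complement is immaterial, and for \<open>V = UNIV\<close> one gets all functionals.\<close>

definition dual_on :: "(real ^ 'n) set \<Rightarrow> ((real ^ 'n) \<Rightarrow>\<^sub>L real) set" where
  "dual_on V = {f. \<forall>x\<in>V\<^sup>\<bottom>. blinfun_apply f x = 0}"

text \<open>The transpose of \<open>\<delta> : V \<rightarrow> V \<otimes> V\<close>, as a bilinear operation on the dual of \<open>V\<close>: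
  the functional \<open>X \<mapsto> (f \<otimes> g)(\<delta> X)\<close> on \<open>V\<close>.\<close>

definition dual_bracket ::
  "(real ^ 'n) set \<Rightarrow> (real ^ 'n \<Rightarrow> real ^ 'n ^ 'n) \<Rightarrow>
   ((real ^ 'n) \<Rightarrow>\<^sub>L real) \<Rightarrow> ((real ^ 'n) \<Rightarrow>\<^sub>L real) \<Rightarrow> ((real ^ 'n) \<Rightarrow>\<^sub>L real)" where
  "dual_bracket V \<delta> f g =
     (THE h. h \<in> dual_on V \<and> (\<forall>X\<in>V. blinfun_apply h X = tensor_pairing f g (\<delta> X)))"

text \<open>\<open>\<delta>\<close> is a Lie bialgebra structure on the Lie subalgebra \<open>V\<close> of \<open>(real ^ 'n, br)\<close>.
  Only the values of \<open>\<delta>\<close> on \<open>V\<close> matter.\<close>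

definition lie_bialgebra ::
  "(real ^ 'n \<Rightarrow> real ^ 'n \<Rightarrow> real ^ 'n) \<Rightarrow> (real ^ 'n) set \<Rightarrow>
   (real ^ 'n \<Rightarrow> real ^ 'n ^ 'n) \<Rightarrow> bool" where
  "lie_bialgebra br V \<delta> \<longleftrightarrow>
     lie_algebra_on UNIV br \<and> lie_algebra_on V br \<and>
     linear_on V \<delta> \<and> (\<forall>X\<in>V. \<delta> X \<in> tensor_square V) \<and>
     (\<forall>X\<in>V. \<forall>Y\<in>V. \<delta> (br X Y) = comm_right br (\<delta> X) Y + comm_left br X (\<delta> Y)) \<and>
     lie_algebra_on (dual_on V) (dual_bracket V \<delta>)"

definition lie_sub_bialgebra ::
  "(real ^ 'n \<Rightarrow> real ^ 'n \<Rightarrow> real ^ 'n) \<Rightarrow>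
   (real ^ 'n) set \<Rightarrow> (real ^ 'n \<Rightarrow> real ^ 'n ^ 'n) \<Rightarrow>
   (real ^ 'n) set \<Rightarrow> (real ^ 'n \<Rightarrow> real ^ 'n ^ 'n) \<Rightarrow> bool" where
  "lie_sub_bialgebra br V \<delta>\<^sub>V W \<delta>\<^sub>W \<longleftrightarrow>
     lie_bialgebra br V \<delta>\<^sub>V \<and> lie_bialgebra br W \<delta>\<^sub>W \<and> V \<subseteq> W \<and>
     (\<forall>X\<in>V. \<delta>\<^sub>W X \<in> wedge_square V \<and> \<delta>\<^sub>W X = \<delta>\<^sub>V X)"

text \<open>\<open>\<delta>\<close> is the coboundary of the skew-symmetric \<open>r\<close>; that \<open>\<delta>\<close> is a Lie bialgebra
  structure is not part of the definition.\<close>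

definition coboundary ::
  "(real ^ 'n \<Rightarrow> real ^ 'n \<Rightarrow> real ^ 'n) \<Rightarrow> real ^ 'n ^ 'n \<Rightarrow>
   (real ^ 'n \<Rightarrow> real ^ 'n ^ 'n) \<Rightarrow> bool" where
  "coboundary br r \<delta> \<longleftrightarrow> transpose r = - r \<and> (\<forall>X. \<delta> X = comm_left br X r)"


section \<open>The Schroedinger algebra\<close>

datatype gen = GenD | GenH | GenP | GenK | GenC | GenM

lemma UNIV_gen: "(UNIV :: gen set) = {GenD, GenH, GenP, GenK, GenC, GenM}"
proof -
  have "x \<in> {GenD, GenH, GenP, GenK, GenC, GenM}" for x
    by (cases x) simp_all
  then show ?thesis by blast
qed

instance gen :: finite
  by standard (simp add: UNIV_gen)

abbreviation gen_D :: "real ^ gen" (\<open>\<D>\<close>) where "\<D> \<equiv> axis GenD 1"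
abbreviation gen_H :: "real ^ gen" (\<open>\<H>\<close>) where "\<H> \<equiv> axis GenH 1"
abbreviation gen_P :: "real ^ gen" (\<open>\<P>\<close>) where "\<P> \<equiv> axis GenP 1"
abbreviation gen_K :: "real ^ gen" (\<open>\<K>\<close>) where "\<K> \<equiv> axis GenK 1"
abbreviation gen_C :: "real ^ gen" (\<open>\<C>\<close>) where "\<C> \<equiv> axis GenC 1"
abbreviation gen_M :: "real ^ gen" (\<open>\<M>\<close>) where "\<M> \<equiv> axis GenM 1"

text \<open>Each nonzero bracket of generators is listed in one order only;
  \<open>schr_bracket\<close> is its bilinear antisymmetric extension.\<close>

fun half_bracket :: "gen \<Rightarrow> gen \<Rightarrow> real ^ gen" where
  "half_bracket GenD GenP = - \<P>"
| "half_bracket GenD GenK = \<K>"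
| "half_bracket GenK GenP = \<M>"
| "half_bracket GenD GenH = - 2 *\<^sub>R \<H>"
| "half_bracket GenD GenC = 2 *\<^sub>R \<C>"
| "half_bracket GenH GenC = \<D>"
| "half_bracket GenK GenH = \<P>"
| "half_bracket GenP GenC = - \<K>"
| "half_bracket _ _ = 0"

definition schr_bracket :: "real ^ gen \<Rightarrow> real ^ gen \<Rightarrow> real ^ gen" where
  "schr_bracket X Y =
     (\<Sum>i\<in>UNIV. \<Sum>j\<in>UNIV. (X $ i * Y $ j) *\<^sub>R (half_bracket i j - half_bracket j i))"

definition h4 :: "(real ^ gen) set" where
  "h4 = span {\<D>, \<P>, \<K>, \<M>}"

definition r_schr :: "real \<Rightarrow> real \<Rightarrow> real \<Rightarrow> real \<Rightarrow> real \<Rightarrow> real \<Rightarrow> real ^ gen ^ gen" where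
  "r_schr \<alpha>\<^sub>p \<alpha>\<^sub>m \<beta>\<^sub>p \<beta>\<^sub>m \<theta> \<xi> =
     - \<alpha>\<^sub>p *\<^sub>R \<D> \<^bold>\<and> \<P> - \<alpha>\<^sub>m *\<^sub>R \<D> \<^bold>\<and> \<K> + \<beta>\<^sub>p *\<^sub>R \<P> \<^bold>\<and> \<M> + \<beta>\<^sub>m *\<^sub>R \<K> \<^bold>\<and> \<M>
     - \<theta> *\<^sub>R \<D> \<^bold>\<and> \<M> + \<xi> *\<^sub>R \<P> \<^bold>\<and> \<K>"

definition admissible :: "real \<Rightarrow> real \<Rightarrow> real \<Rightarrow> real \<Rightarrow> bool" where
  "admissible \<alpha>\<^sub>p \<alpha>\<^sub>m \<theta> \<xi> \<longleftrightarrow> \<alpha>\<^sub>p * \<alpha>\<^sub>m = 0 \<and> \<alpha>\<^sub>p * (\<xi> + \<theta>) = 0 \<and> \<alpha>\<^sub>m * (\<xi> - \<theta>) = 0"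

end

theory Submission
  imports Defs
begin

text \<open>Over a coordinate subspace, a Lie bialgebra structure amounts to structure constants that are
  skew, satisfy the cocycle equations on pairs of generators and the co-Jacobi identity.
  On \<open>h\<^sub>4\<close> the linear cocycle equations leave six free constants, which are the parameters of \<open>r\<close>,
  and the co-Jacobi identity evaluated at three index tuples gives the admissibility constraints.
  Conversely \<open>X \<mapsto> [1 \<otimes> X + X \<otimes> 1, r]\<close> is a cocycle because \<open>S \<otimes> S\<close> is a representation,
  and it satisfies the co-Jacobi identity for admissible parameters.
  The extension to the whole algebra is unique because a skew cocycle vanishing on \<open>h\<^sub>4\<close> sends \<open>H\<close> to
  an element of \<open>D\<close>-weight \<open>-2\<close>, that is a combination of \<open>D \<and> H\<close> and \<open>H \<and> M\<close>, annihilated by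
  \<open>P\<close> and \<open>K\<close>, hence to \<open>0\<close>; likewise for \<open>C\<close>.\<close>

section \<open>Coordinate subspaces and their tensor squares\<close>

text \<open>With \<open>S\<close> a set of generators this covers both the subalgebra
  \<open>h4\<close> and, for \<open>S = UNIV\<close>, the whole algebra. Membership in tensor
  squares and in duals then becomes a condition on supports.\<close>

definition coord_space :: "'n set \<Rightarrow> (real ^ 'n) set" where
  "coord_space S = {x. \<forall>i. i \<notin> S \<longrightarrow> x $ i = 0}"

lemma subspace_coord_space: "subspace (coord_space S)"
  by (auto simp: coord_space_def subspace_def)

lemma coord_space_UNIV [simp]: "coord_space UNIV = UNIV"
  by (simp add: coord_space_def)

lemma axis_in_coord_space [simp]: "axis i 1 \<in> coord_space S \<longleftrightarrow> i \<in> S"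
  by (auto simp: coord_space_def axis_def)

lemma linear_on_UNIV: "linear_on UNIV f \<longleftrightarrow> linear f"
  by (simp add: linear_on_def linear_iff)

lemma linear_on_subset: "linear_on W f \<Longrightarrow> V \<subseteq> W \<Longrightarrow> linear_on V f"
  unfolding linear_on_def by blast

lemma linear_on_sum:
  assumes "subspace V" "linear_on V f" "finite A" "\<And>i. i \<in> A \<Longrightarrow> g i \<in> V"
  shows "f (\<Sum>i\<in>A. u i *\<^sub>R g i) = (\<Sum>i\<in>A. u i *\<^sub>R f (g i))"
  using assms(3,4)
proof (induction A rule: finite_induct)
  case empty
  have "f (0 *\<^sub>R 0) = 0 *\<^sub>R f 0"
    using assms(1,2) subspace_0 unfolding linear_on_def by blast
  then show ?case by simp
next
  case (insert i A)
  have "(\<Sum>i\<in>A. u i *\<^sub>R g i) \<in> V"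
    using insert.prems assms(1) by (intro subspace_sum subspace_scale) auto
  then show ?case
    using insert assms(1,2) unfolding linear_on_def
    by (simp add: subspace_scale)
qed

lemma coord_space_expansion:
  assumes "x \<in> coord_space S"
  shows "x = (\<Sum>i\<in>S. x $ i *\<^sub>R axis i 1)"
  using assms
  by (auto simp: vec_eq_iff coord_space_def axis_def if_distrib cong: if_cong)

lemma linear_on_coord_space:
  assumes "linear_on (coord_space S) f" "x \<in> coord_space S"
  shows "f x = (\<Sum>i\<in>S. x $ i *\<^sub>R f (axis i 1))"
  by (subst coord_space_expansion[OF assms(2)])
    (rule linear_on_sum[OF subspace_coord_space assms(1)], auto)

lemma linear_on_eqI:
  assumes "linear_on (coord_space S) f" "linear_on (coord_space S) g"
    and "\<And>i. i \<in> S \<Longrightarrow> f (axis i 1) = g (axis i 1)" "x \<in> coord_space S"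
  shows "f x = g x"
  using linear_on_coord_space[OF assms(1,4)] linear_on_coord_space[OF assms(2,4)] assms(3)
  by simp

section \<open>Entries, supports and skew-symmetry of tensors\<close>

lemma tensor_nth [simp]: "(x \<otimes> y) $ i $ j = x $ i * y $ j"
  by (simp add: tensor_def)

lemma wedge_nth [simp]: "(x \<^bold>\<and> y) $ i $ j = x $ i * y $ j - y $ i * x $ j"
  by (simp add: wedge_def)

text \<open>The entries of the axis vectors are Kronecker deltas, so only the term
  \<open>i = a\<close>, \<open>j = b\<close> survives.\<close>

lemma sum_axis_tensor:
  "(\<Sum>i\<in>UNIV. \<Sum>j\<in>UNIV. c i j * (axis i 1 $ a * axis j 1 $ b)) = (c a b :: real)"
proof -
  have "(\<Sum>j\<in>UNIV. c i j * (axis i 1 $ a * axis j 1 $ b)) = (if i = a then c i b else 0)" for i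
    by (cases "i = a") (simp_all add: axis_def if_distrib cong: if_cong)
  then show ?thesis by simp
qed

lemma sum_axis_tensor3:
  "(\<Sum>i\<in>UNIV. \<Sum>j\<in>UNIV. \<Sum>l\<in>UNIV.
      (axis i 1 $ a * axis j 1 $ b * axis l 1 $ d) * c i j l) = (c a b d :: real)"
proof -
  have "(\<Sum>l\<in>UNIV. (axis i 1 $ a * axis j 1 $ b * axis l 1 $ d) * c i j l) =
      c i j d * (axis i 1 $ a * axis j 1 $ b)" for i j
    by (simp add: axis_def mult.assoc mult_if_delta flip: sum_distrib_left)
  then show ?thesis by (simp add: sum_axis_tensor)
qed

lemma skew_nth:
  assumes "transpose t = - t"
  shows "t $ j $ i = - (t $ i $ j :: 'a::ab_group_add)"
proof -
  have "transpose t $ i $ j = (- t) $ i $ j" using assms by simp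
  then show ?thesis by (simp add: transpose_def)
qed

lemma transpose_eq_minusI:
  assumes "\<And>i j. t $ j $ i = - (t $ i $ j :: 'a::ab_group_add)"
  shows "transpose t = - t"
  unfolding vec_eq_iff by (auto simp: transpose_def intro: assms)

text \<open>One direction is span induction, the support condition being linear. The other expands
  \<open>t\<close> in the products \<open>axis i 1 \<otimes> axis j 1\<close> and uses only the
  pairs with a nonzero coefficient.\<close>

lemma tensor_square_coord_space:
  "t \<in> tensor_square (coord_space S) \<longleftrightarrow> (\<forall>i j. t $ i $ j \<noteq> 0 \<longrightarrow> i \<in> S \<and> j \<in> S)"
proof
  assume "t \<in> tensor_square (coord_space S)"
  then show "\<forall>i j. t $ i $ j \<noteq> 0 \<longrightarrow> i \<in> S \<and> j \<in> S"
    unfolding tensor_square_def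
  proof (rule span_induct)
    show "subspace {t :: real ^ 'a ^ 'a. \<forall>i j. t $ i $ j \<noteq> 0 \<longrightarrow> i \<in> S \<and> j \<in> S}"
      unfolding subspace_def by (auto, (metis add_0)+)
  qed (auto simp: coord_space_def)
next
  assume t: "\<forall>i j. t $ i $ j \<noteq> 0 \<longrightarrow> i \<in> S \<and> j \<in> S"
  have "t = (\<Sum>i\<in>UNIV. \<Sum>j\<in>UNIV. t $ i $ j *\<^sub>R (axis i 1 \<otimes> axis j 1))"
    by (simp add: vec_eq_iff sum_axis_tensor)
  also have "\<dots> \<in> tensor_square (coord_space S)"
    unfolding tensor_square_def
  proof (intro span_sum)
    fix i j
    show "t $ i $ j *\<^sub>R (axis i 1 \<otimes> axis j 1)
        \<in> span {x \<otimes> y |x y. x \<in> coord_space S \<and> y \<in> coord_space S}"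
    proof (cases "t $ i $ j = 0")
      case False
      then show ?thesis using t by (intro span_scale span_base) force
    qed (simp add: span_zero)
  qed
  finally show "t \<in> tensor_square (coord_space S)" .
qed

lemma wedge_square_coord_space:
  fixes t :: "real ^ 'n ^ 'n"
  assumes "transpose t = - t" "t \<in> tensor_square (coord_space S)"
  shows "t \<in> wedge_square (coord_space S)"
proof -
  \<comment> \<open>The factor 1/2 is due to the sum running over ordered pairs, so that each wedge
    of two axes occurs twice.\<close>
  have "(\<Sum>i\<in>UNIV. \<Sum>j\<in>UNIV. (t $ i $ j / 2) *\<^sub>R (axis i 1 \<^bold>\<and> axis j 1)) $ a $ b
      = t $ a $ b" for a b
    using skew_nth[OF assms(1), of a b]
      sum_axis_tensor[of "\<lambda>i j. t $ i $ j / 2" a b] sum_axis_tensor[of "\<lambda>i j. t $ i $ j / 2" b a]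
    by (simp add: right_diff_distrib sum_subtractf mult_ac)
  then have "t = (\<Sum>i\<in>UNIV. \<Sum>j\<in>UNIV. (t $ i $ j / 2) *\<^sub>R (axis i 1 \<^bold>\<and> axis j 1))"
    by (simp add: vec_eq_iff)
  also have "\<dots> \<in> wedge_square (coord_space S)"
    unfolding wedge_square_def
  proof (intro span_sum)
    fix i j
    show "(t $ i $ j / 2) *\<^sub>R (axis i 1 \<^bold>\<and> axis j 1)
        \<in> span {x \<^bold>\<and> y |x y. x \<in> coord_space S \<and> y \<in> coord_space S}"
    proof (cases "t $ i $ j = 0")
      case False
      then show ?thesis
        using assms(2) unfolding tensor_square_coord_space
        by (intro span_scale span_base) force
    qed (simp add: span_zero)
  qed
  finally show ?thesis .
qed

section \<open>The adjoint action on tensors\<close>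

text \<open>The first sum is the action on the second tensor factor, the second sum the action on
  the first. All explicit computations of cocommutators go through this formula.\<close>

lemma comm_left_nth:
  "comm_left br X t $ a $ b =
     (\<Sum>j\<in>UNIV. t $ a $ j * br X (axis j 1) $ b) + (\<Sum>i\<in>UNIV. t $ i $ b * br X (axis i 1) $ a)"
proof -
  have "comm_left br X t $ a $ b =
      (\<Sum>i\<in>UNIV. \<Sum>j\<in>UNIV. if i = a then t $ i $ j * br X (axis j 1) $ b else 0)
      + (\<Sum>i\<in>UNIV. \<Sum>j\<in>UNIV. if j = b then t $ i $ j * br X (axis i 1) $ a else 0)"
    unfolding comm_left_def sum.distrib[symmetric]
    by (auto simp: axis_def algebra_simps intro!: sum.cong)
  also have "(\<Sum>i\<in>UNIV. \<Sum>j\<in>UNIV. if i = a then t $ i $ j * br X (axis j 1) $ b else 0)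
      = (\<Sum>j\<in>UNIV. t $ a $ j * br X (axis j 1) $ b)"
    by (subst sum.swap) simp
  finally show ?thesis by simp
qed

lemma linear_comm_left: "linear (comm_left br X)"
  by (rule linearI)
    (auto simp: vec_eq_iff comm_left_nth algebra_simps sum.distrib sum_distrib_left)

lemma
  assumes "lie_algebra_on UNIV br"
  shows lie_algebra_linear_right: "linear (br X)"
    and lie_algebra_linear_left: "linear (\<lambda>Y. br Y X)"
    and lie_algebra_alternating: "br X X = 0"
    and lie_algebra_jacobi: "br X (br Y Z) + br Y (br Z X) + br Z (br X Y) = 0"
  using assms by (auto simp: lie_algebra_on_def linear_on_UNIV)

lemma lie_algebra_antisym:
  assumes "lie_algebra_on UNIV br"
  shows "br X Y = - br Y X"
proof -
  note lin = linear_add[OF lie_algebra_linear_right[OF assms]]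
    linear_add[OF lie_algebra_linear_left[OF assms]]
  have "br (X + Y) (X + Y) = br X Y + br Y X"
    unfolding lin by (simp add: lie_algebra_alternating[OF assms])
  then show ?thesis
    by (simp add: lie_algebra_alternating[OF assms] eq_neg_iff_add_eq_0)
qed

text \<open>Antisymmetry applied in each factor. The cocycle condition can thus be written with the
  left action alone.\<close>

lemma comm_right_eq:
  assumes "lie_algebra_on UNIV br"
  shows "comm_right br t Y = - comm_left br Y t"
proof -
  have "axis i 1 \<otimes> br (axis j 1) Y + br (axis i 1) Y \<otimes> axis j 1
      = - (axis i 1 \<otimes> br Y (axis j 1) + br Y (axis i 1) \<otimes> axis j 1)" for i j
    unfolding lie_algebra_antisym[OF assms, of _ Y] by (simp add: vec_eq_iff)
  then show ?thesis
    by (simp add: comm_right_def comm_left_def sum_negf del: minus_add_distrib)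
qed

text \<open>The Leibniz rule on decomposable tensors, obtained by expanding \<open>br X x\<close>
  and \<open>br X y\<close> in the basis.\<close>

lemma comm_left_tensor:
  assumes "lie_algebra_on UNIV br"
  shows "comm_left br X (x \<otimes> y) = x \<otimes> br X y + br X x \<otimes> y"
proof -
  have lin: "linear_on (coord_space UNIV) (br X)"
    using lie_algebra_linear_right[OF assms] by (simp add: linear_on_UNIV)
  have expand: "br X z $ b = (\<Sum>j\<in>UNIV. z $ j * br X (axis j 1) $ b)" for z b
    by (subst linear_on_coord_space[OF lin]) simp_all
  have "comm_left br X (x \<otimes> y) $ a $ b = (x \<otimes> br X y + br X x \<otimes> y) $ a $ b" for a b
    unfolding comm_left_nth vector_add_component tensor_nth expand[of x] expand[of y]
    by (simp only: sum_distrib_left sum_distrib_right mult_ac)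
  then show ?thesis by (simp add: vec_eq_iff)
qed

lemma linear_comm_left_arg:
  assumes "lie_algebra_on UNIV br"
  shows "linear (\<lambda>X. comm_left br X t)"
  by (rule linearI)
    (simp_all add: vec_eq_iff comm_left_nth linear_add[OF lie_algebra_linear_left[OF assms]]
      linear_scale[OF lie_algebra_linear_left[OF assms]] algebra_simps sum.distrib sum_distrib_left)

text \<open>On a decomposable tensor the mixed terms, in which \<open>X\<close> acts on one factor
  and \<open>Y\<close> on the other, cancel in the commutator; what remains is the Jacobi identity
  in each factor. Read as a statement about \<open>X \<mapsto> comm_left br X t\<close>, this says
  that every coboundary is a cocycle.\<close>

lemma comm_left_bracket:
  assumes "lie_algebra_on UNIV br"
  shows "comm_left br (br X Y) t =
    comm_left br X (comm_left br Y t) - comm_left br Y (comm_left br X t)"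
proof -
  have lin: "linear (\<lambda>t. comm_left br X (comm_left br Y t) - comm_left br Y (comm_left br X t))"
    by (rule linearI)
      (simp_all add: linear_add[OF linear_comm_left] linear_scale[OF linear_comm_left] algebra_simps)
  have jac: "br (br X Y) z = br X (br Y z) - br Y (br X z)" for z
  proof -
    have "br Y (br z X) = - br Y (br X z)"
      by (subst lie_algebra_antisym[OF assms, of z X])
        (rule linear_neg[OF lie_algebra_linear_right[OF assms]])
    then have "br z (br X Y) = br Y (br X z) - br X (br Y z)"
      using lie_algebra_jacobi[OF assms, of X Y z] by (simp add: algebra_simps)
    then show ?thesis
      by (subst lie_algebra_antisym[OF assms]) simp
  qed
  have "comm_left br (br X Y) b =
      comm_left br X (comm_left br Y b) - comm_left br Y (comm_left br X b)" if b: "b \<in> Basis" for b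
  proof -
    \<comment> \<open>The standard basis of the matrix space consists of decomposable tensors, so
      the Leibniz rule applies to each basis element.\<close>
    have "axis i (axis j 1) = axis i 1 \<otimes> axis j 1" for i j :: 'a
      by (simp add: vec_eq_iff axis_def)
    then obtain i j where "b = axis i 1 \<otimes> axis j 1"
      using b by (auto simp: Basis_vec_def)
    then show ?thesis
      by (simp add: comm_left_tensor[OF assms] linear_add[OF linear_comm_left] jac)
        (simp add: vec_eq_iff algebra_simps)
  qed
  then show ?thesis
    using linear_eq_stdbasis[OF linear_comm_left lin] by (metis (no_types, lifting))
qed

section \<open>The dual bracket in coordinates\<close>

lemma linear_on_blinfun: "linear_on V (blinfun_apply f)"
  by (simp add: linear_on_def blinfun.add_right blinfun.scaleR_right)

lemma blinfun_axis_eqI: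
  fixes f g :: "(real ^ 'n) \<Rightarrow>\<^sub>L real"
  assumes "\<And>i. blinfun_apply f (axis i 1) = blinfun_apply g (axis i 1)"
  shows "f = g"
  using linear_on_eqI[OF linear_on_blinfun linear_on_blinfun, of UNIV f g] assms
  by (auto intro: blinfun_eqI)

text \<open>The orthogonal complement of a coordinate subspace is the coordinate subspace of the
  complementary index set.\<close>

lemma dual_on_coord_space:
  "f \<in> dual_on (coord_space S) \<longleftrightarrow> (\<forall>i. i \<notin> S \<longrightarrow> blinfun_apply f (axis i 1) = 0)"
proof -
  have *: "(coord_space S)\<^sup>\<bottom> = coord_space (- S)"
  proof (intro set_eqI iffI)
    fix y :: "real ^ 'a"
    assume y: "y \<in> (coord_space S)\<^sup>\<bottom>"
    have "y $ i = 0" if "i \<in> S" for i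
    proof -
      have "axis i 1 \<bullet> y = 0"
        using y that by (auto simp: orthogonal_comp_def orthogonal_def inner_commute)
      then show ?thesis by (simp add: inner_axis')
    qed
    then show "y \<in> coord_space (- S)" by (simp add: coord_space_def)
  next
    fix y :: "real ^ 'a"
    assume "y \<in> coord_space (- S)"
    then have "x $ i * y $ i = 0" if "x \<in> coord_space S" for x i
      using that by (cases "i \<in> S") (auto simp: coord_space_def)
    then show "y \<in> (coord_space S)\<^sup>\<bottom>"
      by (auto simp: orthogonal_comp_def orthogonal_def inner_vec_def mult.commute intro!: sum.neutral)
  qed
  show ?thesis
  proof
    assume "f \<in> dual_on (coord_space S)"
    then show "\<forall>i. i \<notin> S \<longrightarrow> blinfun_apply f (axis i 1) = 0"
      by (simp add: dual_on_def *)
  next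
    assume f: "\<forall>i. i \<notin> S \<longrightarrow> blinfun_apply f (axis i 1) = 0"
    have "blinfun_apply f x = 0" if "x \<in> coord_space (- S)" for x
      using linear_on_eqI[OF linear_on_blinfun[of _ f] linear_on_blinfun[of _ 0] _ that] f by simp
    then show "f \<in> dual_on (coord_space S)"
      by (simp add: dual_on_def *)
  qed
qed

lemma subspace_dual_on: "subspace (dual_on V)"
  by (auto simp: dual_on_def subspace_def blinfun.add_left blinfun.scaleR_left)

lemma linear_tensor_pairing: "linear (tensor_pairing f g)"
  by (rule linearI) (auto simp: tensor_pairing_def algebra_simps sum.distrib sum_distrib_left)

text \<open>Resolves the definite description. The functional \<open>h\<close> built from the
  prescribed values on the axes satisfies the defining property, and any other solution agrees with
  it on all axes: by that property on \<open>S\<close>, and by vanishing outside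
  \<open>S\<close>.\<close>

lemma dual_bracket_coord_space:
  assumes "linear_on (coord_space S) \<delta>"
  shows "dual_bracket (coord_space S) \<delta> f g \<in> dual_on (coord_space S)" (is ?A)
    and "blinfun_apply (dual_bracket (coord_space S) \<delta> f g) (axis a 1) =
      (if a \<in> S then tensor_pairing f g (\<delta> (axis a 1)) else 0)" (is ?B)
proof -
  define h where "h = blinfun_inner_left
    (\<chi> a. if a \<in> S then tensor_pairing f g (\<delta> (axis a 1)) else 0)"
  have h_axis: "blinfun_apply h (axis a 1) =
      (if a \<in> S then tensor_pairing f g (\<delta> (axis a 1)) else 0)" for a
    by (simp add: h_def inner_axis' inner_axis)
  have lin: "linear_on (coord_space S) (\<lambda>X. tensor_pairing f g (\<delta> X))"
    using assms linear_tensor_pairing[of f g]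
    unfolding linear_on_def by (simp add: linear_add linear_scale)
  have h: "h \<in> dual_on (coord_space S) \<and>
      (\<forall>X\<in>coord_space S. blinfun_apply h X = tensor_pairing f g (\<delta> X))"
    using linear_on_eqI[OF linear_on_blinfun lin] by (auto simp: dual_on_coord_space h_axis)
  have "dual_bracket (coord_space S) \<delta> f g = h"
    unfolding dual_bracket_def
  proof (rule the_equality)
    show "h \<in> dual_on (coord_space S) \<and>
      (\<forall>X\<in>coord_space S. blinfun_apply h X = tensor_pairing f g (\<delta> X))"
      by (rule h)
  next
    fix k
    assume k: "k \<in> dual_on (coord_space S) \<and>
      (\<forall>X\<in>coord_space S. blinfun_apply k X = tensor_pairing f g (\<delta> X))"
    show "k = h"
      by (rule blinfun_axis_eqI) (use k h in \<open>metis dual_on_coord_space axis_in_coord_space\<close>)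
  qed
  then show ?A ?B using h h_axis by auto
qed

text \<open>If \<open>c k $ i $ j\<close> are the structure constants of the bracket on the dual
  basis, this is coordinate \<open>a\<close> of the cyclic Jacobi sum for the dual basis elements
  with indices \<open>i\<close>, \<open>j\<close>, \<open>l\<close>.\<close>

definition co_jacobiator :: "('n::finite \<Rightarrow> real ^ 'n ^ 'n) \<Rightarrow> 'n \<Rightarrow> 'n \<Rightarrow> 'n \<Rightarrow> 'n \<Rightarrow> real" where
  "co_jacobiator c a i j l = (\<Sum>k\<in>UNIV.
     c a $ i $ k * c k $ j $ l + c a $ j $ k * c k $ l $ i + c a $ l $ k * c k $ i $ j)"

text \<open>Here \<open>h\<close> stands for the inner bracket of \<open>g\<close> and
  \<open>g'\<close>, so that pairing \<open>f\<close> with \<open>h\<close> expands an iterated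
  bracket into structure constants.\<close>

lemma tensor_pairing_nested:
  assumes "\<And>k. k \<notin> S \<Longrightarrow> blinfun_apply h (axis k 1) = 0"
    and "\<And>k. k \<in> S \<Longrightarrow> blinfun_apply h (axis k 1) = tensor_pairing g g' (c k)"
    and "\<And>i k. k \<notin> S \<Longrightarrow> t $ i $ k = 0"
  shows "tensor_pairing f h t = (\<Sum>i\<in>UNIV. \<Sum>j\<in>UNIV. \<Sum>l\<in>UNIV.
    (blinfun_apply f (axis i 1) * blinfun_apply g (axis j 1) * blinfun_apply g' (axis l 1)) *
    (\<Sum>k\<in>UNIV. t $ i $ k * c k $ j $ l))"
proof -
  have "tensor_pairing f h t = (\<Sum>i\<in>UNIV. \<Sum>k\<in>UNIV.
      t $ i $ k * (blinfun_apply f (axis i 1) * tensor_pairing g g' (c k)))"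
    unfolding tensor_pairing_def[of f h]
    \<comment> \<open>For \<open>k\<close> outside \<open>S\<close> the coefficient
      \<open>t $ i $ k\<close> is zero, so \<open>h\<close> may be replaced by the pairing with
      \<open>c k\<close> there as well.\<close>
    by (intro sum.cong refl) (metis assms mult_zero_left)
  also have "\<dots> = (\<Sum>i\<in>UNIV. \<Sum>k\<in>UNIV. \<Sum>j\<in>UNIV. \<Sum>l\<in>UNIV.
    (blinfun_apply f (axis i 1) * blinfun_apply g (axis j 1) * blinfun_apply g' (axis l 1)) *
    (t $ i $ k * c k $ j $ l))"
    by (simp add: tensor_pairing_def sum_distrib_left mult_ac)
  also have "\<dots> = (\<Sum>i\<in>UNIV. \<Sum>j\<in>UNIV. \<Sum>k\<in>UNIV. \<Sum>l\<in>UNIV.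
    (blinfun_apply f (axis i 1) * blinfun_apply g (axis j 1) * blinfun_apply g' (axis l 1)) *
    (t $ i $ k * c k $ j $ l))"
    by (intro sum.cong refl sum.swap)
  also have "\<dots> = (\<Sum>i\<in>UNIV. \<Sum>j\<in>UNIV. \<Sum>l\<in>UNIV. \<Sum>k\<in>UNIV.
    (blinfun_apply f (axis i 1) * blinfun_apply g (axis j 1) * blinfun_apply g' (axis l 1)) *
    (t $ i $ k * c k $ j $ l))"
    by (intro sum.cong refl sum.swap)
  finally show ?thesis by (simp add: sum_distrib_left)
qed

lemma sum3_rotate:
  fixes F :: "'a::finite \<Rightarrow> 'a \<Rightarrow> 'a \<Rightarrow> real"
  shows "(\<Sum>i\<in>UNIV. \<Sum>j\<in>UNIV. \<Sum>l\<in>UNIV. F i j l) = (\<Sum>i\<in>UNIV. \<Sum>j\<in>UNIV. \<Sum>l\<in>UNIV. F j l i)"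
proof -
  have "(\<Sum>i\<in>UNIV. \<Sum>j\<in>UNIV. \<Sum>l\<in>UNIV. F j l i) = (\<Sum>j\<in>UNIV. \<Sum>i\<in>UNIV. \<Sum>l\<in>UNIV. F j l i)"
    by (rule sum.swap)
  also have "\<dots> = (\<Sum>j\<in>UNIV. \<Sum>l\<in>UNIV. \<Sum>i\<in>UNIV. F j l i)"
    by (intro sum.cong refl sum.swap)
  finally show ?thesis by simp
qed

text \<open>The cyclic sum is trilinear in the functionals, and its coefficients on the dual basis
  are the values of \<open>co_jacobiator\<close>.\<close>

lemma dual_bracket_jacobi_eq:
  assumes lin: "linear_on (coord_space S) \<delta>"
    and supp: "\<And>a. a \<in> S \<Longrightarrow> \<delta> (axis a 1) \<in> tensor_square (coord_space S)"
    and a: "a \<in> S"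
  defines "B \<equiv> dual_bracket (coord_space S) \<delta>"
  shows "blinfun_apply (B f (B g h) + B g (B h f) + B h (B f g)) (axis a 1) =
    (\<Sum>i\<in>UNIV. \<Sum>j\<in>UNIV. \<Sum>l\<in>UNIV.
      (blinfun_apply f (axis i 1) * blinfun_apply g (axis j 1) * blinfun_apply h (axis l 1)) *
      co_jacobiator (\<lambda>k. \<delta> (axis k 1)) a i j l)"
proof -
  have *: "blinfun_apply (B u (B v w)) (axis a 1) = (\<Sum>i\<in>UNIV. \<Sum>j\<in>UNIV. \<Sum>l\<in>UNIV.
    (blinfun_apply u (axis i 1) * blinfun_apply v (axis j 1) * blinfun_apply w (axis l 1)) *
    (\<Sum>k\<in>UNIV. \<delta> (axis a 1) $ i $ k * \<delta> (axis k 1) $ j $ l))" for u v w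
    using a supp[OF a] unfolding B_def
    by (simp add: dual_bracket_coord_space[OF lin])
      (rule tensor_pairing_nested[where S = S],
        auto simp: dual_bracket_coord_space[OF lin] tensor_square_coord_space)
  show ?thesis
    \<comment> \<open>The second and third summands carry cyclically permuted indices; relabelling
      by \<open>sum3_rotate\<close> aligns them with the common factor.\<close>
    unfolding co_jacobiator_def sum.distrib distrib_left blinfun.add_left *
    by (intro arg_cong2[where f = plus] refl)
      (subst sum3_rotate, simp add: mult_ac, subst (2) sum3_rotate, simp add: mult_ac)
qed

lemma linear_dual_bracket:
  assumes "linear_on (coord_space S) \<delta>"
  shows "linear (\<lambda>g. dual_bracket (coord_space S) \<delta> f g)"
    and "linear (\<lambda>g. dual_bracket (coord_space S) \<delta> g f)"
  by (rule linearI; rule blinfun_axis_eqI;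
      simp add: blinfun.add_left blinfun.scaleR_left dual_bracket_coord_space[OF assms]
        tensor_pairing_def algebra_simps sum.distrib sum_distrib_left)+

lemma tensor_pairing_skew:
  assumes "transpose t = - t"
  shows "tensor_pairing f f t = 0"
proof -
  have "tensor_pairing f f t = (\<Sum>j\<in>UNIV. \<Sum>i\<in>UNIV.
      t $ i $ j * (blinfun_apply f (axis i 1) * blinfun_apply f (axis j 1)))"
    unfolding tensor_pairing_def by (rule sum.swap)
  also have "\<dots> = - tensor_pairing f f t"
    unfolding tensor_pairing_def sum_negf[symmetric]
    by (intro sum.cong refl) (subst skew_nth[OF assms], simp add: mult_ac)
  finally show ?thesis by simp
qed

text \<open>Skewness of the tensors gives the alternating law, and the vanishing of
  \<open>co_jacobiator\<close> gives the Jacobi identity through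
  \<open>dual_bracket_jacobi_eq\<close>. On axes outside \<open>S\<close> all brackets are
  zero.\<close>

lemma lie_algebra_on_dualI:
  assumes lin: "linear_on (coord_space S) \<delta>"
    and supp: "\<And>a. a \<in> S \<Longrightarrow> \<delta> (axis a 1) \<in> tensor_square (coord_space S)"
    and skew: "\<And>a. a \<in> S \<Longrightarrow> transpose (\<delta> (axis a 1)) = - \<delta> (axis a 1)"
    and jac: "\<And>a i j l. a \<in> S \<Longrightarrow> co_jacobiator (\<lambda>k. \<delta> (axis k 1)) a i j l = 0"
  shows "lie_algebra_on (dual_on (coord_space S)) (dual_bracket (coord_space S) \<delta>)"
proof -
  let ?B = "dual_bracket (coord_space S) \<delta>"
  have linear: "linear_on (dual_on (coord_space S)) (\<lambda>g. ?B f g)"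
    "linear_on (dual_on (coord_space S)) (\<lambda>g. ?B g f)" for f
    using linear_dual_bracket[OF lin] by (auto intro: linear_on_subset simp flip: linear_on_UNIV)
  have alt: "?B f f = 0" for f
    by (rule blinfun_axis_eqI)
      (simp add: dual_bracket_coord_space[OF lin] tensor_pairing_skew skew)
  have "?B f (?B g h) + ?B g (?B h f) + ?B h (?B f g) = 0" for f g h
  proof (rule blinfun_axis_eqI)
    fix a
    show "blinfun_apply (?B f (?B g h) + ?B g (?B h f) + ?B h (?B f g)) (axis a 1) =
        blinfun_apply 0 (axis a 1)"
    proof (cases "a \<in> S")
      case True
      then show ?thesis
        by (simp only: dual_bracket_jacobi_eq[OF lin supp True] jac) simp
    qed (simp add: blinfun.add_left dual_bracket_coord_space[OF lin])
  qed
  then show ?thesis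
    unfolding lie_algebra_on_def
    using subspace_dual_on dual_bracket_coord_space(1)[OF lin] linear alt by blast
qed

text \<open>The converse reading: evaluating the laws of the dual Lie algebra on the coordinate
  functionals \<open>e i\<close> recovers the conditions on the structure constants.\<close>

lemma
  assumes "lie_bialgebra br (coord_space S) \<delta>" "a \<in> S"
  shows lie_bialgebra_skew: "transpose (\<delta> (axis a 1)) = - \<delta> (axis a 1)"
    and lie_bialgebra_co_jacobi: "i \<in> S \<Longrightarrow> j \<in> S \<Longrightarrow> l \<in> S \<Longrightarrow>
      co_jacobiator (\<lambda>k. \<delta> (axis k 1)) a i j l = 0"
proof -
  let ?B = "dual_bracket (coord_space S) \<delta>"
  have lin: "linear_on (coord_space S) \<delta>"
    and supp: "b \<in> S \<Longrightarrow> \<delta> (axis b 1) \<in> tensor_square (coord_space S)"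
    and lie: "lie_algebra_on (dual_on (coord_space S)) ?B" for b
    using assms by (auto simp: lie_bialgebra_def)
  define e :: "'a \<Rightarrow> (real ^ 'a) \<Rightarrow>\<^sub>L real" where "e i = blinfun_inner_left (axis i 1)" for i
  have e: "blinfun_apply (e i) x = x $ i" for i x
    by (simp add: e_def inner_axis)
  have e_dual: "e i \<in> dual_on (coord_space S)" if "i \<in> S" for i
    using that by (auto simp: dual_on_coord_space e axis_def)
  have pair: "tensor_pairing (e i) (e j) t = t $ i $ j" for i j t
    by (simp add: tensor_pairing_def e sum_axis_tensor)
  have alt: "?B f f = 0" if "f \<in> dual_on (coord_space S)" for f
    using lie that by (simp add: lie_algebra_on_def)
  have skew: "\<delta> (axis a 1) $ i $ j = - \<delta> (axis a 1) $ j $ i" for i j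
  proof (cases "i \<in> S \<and> j \<in> S")
    case True
    \<comment> \<open>Polarization: the alternating law at \<open>e i + e j\<close> yields
      antisymmetry of the bracket.\<close>
    have "?B (e i + e j) (e i + e j) = ?B (e i) (e j) + ?B (e j) (e i)"
      using True alt e_dual
      by (simp add: linear_add[OF linear_dual_bracket(1)[OF lin]]
          linear_add[OF linear_dual_bracket(2)[OF lin]])
    also have "?B (e i + e j) (e i + e j) = 0"
      using True e_dual subspace_dual_on by (intro alt subspace_add) auto
    finally have "blinfun_apply (?B (e i) (e j) + ?B (e j) (e i)) (axis a 1) = 0"
      by (metis zero_blinfun.rep_eq)
    then show ?thesis
      using assms(2) by (simp add: blinfun.add_left dual_bracket_coord_space[OF lin] pair)
  next
    case False
    then have "\<delta> (axis a 1) $ i $ j = 0 \<and> \<delta> (axis a 1) $ j $ i = 0"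
      using supp[OF assms(2)] unfolding tensor_square_coord_space by blast
    then show ?thesis by simp
  qed
  show "transpose (\<delta> (axis a 1)) = - \<delta> (axis a 1)"
    by (rule transpose_eq_minusI) (rule skew)
  show "co_jacobiator (\<lambda>k. \<delta> (axis k 1)) a i j l = 0" if "i \<in> S" "j \<in> S" "l \<in> S"
  proof -
    have "?B (e i) (?B (e j) (e l)) + ?B (e j) (?B (e l) (e i)) + ?B (e l) (?B (e i) (e j)) = 0"
      using lie that e_dual by (simp add: lie_algebra_on_def)
    then have "0 = blinfun_apply
      (?B (e i) (?B (e j) (e l)) + ?B (e j) (?B (e l) (e i)) + ?B (e l) (?B (e i) (e j))) (axis a 1)"
      by simp
    also have "\<dots> = co_jacobiator (\<lambda>k. \<delta> (axis k 1)) a i j l"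
      by (subst dual_bracket_jacobi_eq[OF lin supp assms(2)])
        (simp_all add: e sum_axis_tensor3)
    finally show ?thesis by simp
  qed
qed

section \<open>Criteria for Lie bialgebras and coordinates of the Schouten bracket\<close>

lemma lie_bialgebraI:
  assumes "lie_algebra_on UNIV br" "lie_algebra_on (coord_space S) br"
    and "linear_on (coord_space S) \<delta>"
    and "\<And>X. X \<in> coord_space S \<Longrightarrow> \<delta> X \<in> tensor_square (coord_space S)"
    and "\<And>X Y. X \<in> coord_space S \<Longrightarrow> Y \<in> coord_space S \<Longrightarrow>
      \<delta> (br X Y) = comm_left br X (\<delta> Y) - comm_left br Y (\<delta> X)"
    and "\<And>a. a \<in> S \<Longrightarrow> transpose (\<delta> (axis a 1)) = - \<delta> (axis a 1)"
    and "\<And>a i j l. a \<in> S \<Longrightarrow> co_jacobiator (\<lambda>k. \<delta> (axis k 1)) a i j l = 0"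
  shows "lie_bialgebra br (coord_space S) \<delta>"
  using assms lie_algebra_on_dualI[of S \<delta>]
  by (simp add: lie_bialgebra_def comm_right_eq)

lemma lie_bialgebra_cocycle:
  assumes "lie_bialgebra br V \<delta>" "X \<in> V" "Y \<in> V"
  shows "\<delta> (br X Y) = comm_left br X (\<delta> Y) - comm_left br Y (\<delta> X)"
  using assms by (simp add: lie_bialgebra_def comm_right_eq)

text \<open>Transposition exchanges the two tensor factors, on which \<open>X\<close> acts in the
  same way, so skewness is preserved.\<close>

lemma transpose_comm_left:
  assumes "transpose t = - t"
  shows "transpose (comm_left br X t) = - comm_left br X t"
proof -
  have "(\<Sum>k\<in>UNIV. t $ j $ k * f k) = - (\<Sum>k\<in>UNIV. t $ k $ j * f k)" for f j
    unfolding sum_negf[symmetric]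
    by (intro sum.cong refl) (subst skew_nth[OF assms], simp)
  then have "comm_left br X t $ j $ i = - (comm_left br X t $ i $ j)" for i j
    by (simp add: comm_left_nth)
  then show ?thesis by (rule transpose_eq_minusI)
qed

text \<open>In each of the three contributions two factors are plain axes, whose deltas remove two
  of the four summations. The sums are reordered so that these two are innermost and
  \<open>sum_axis_tensor\<close> applies.\<close>

lemma schouten_nth:
  "schouten br r $ a $ b $ c =
     (\<Sum>i\<in>UNIV. \<Sum>k\<in>UNIV. r $ i $ b * r $ k $ c * br (axis i 1) (axis k 1) $ a)
   + (\<Sum>j\<in>UNIV. \<Sum>k\<in>UNIV. r $ a $ j * r $ k $ c * br (axis j 1) (axis k 1) $ b)
   + (\<Sum>j\<in>UNIV. \<Sum>l\<in>UNIV. r $ a $ j * r $ b $ l * br (axis j 1) (axis l 1) $ c)"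
proof -
  define F where "F i j k l = (r $ i $ j * r $ k $ l) *
    (br (axis i 1) (axis k 1) $ a * axis j 1 $ b * axis l 1 $ c)"
      for i j k l
  define G where "G i j k l = (r $ i $ j * r $ k $ l) *
    (axis i 1 $ a * br (axis j 1) (axis k 1) $ b * axis l 1 $ c)"
      for i j k l
  define H where "H i j k l = (r $ i $ j * r $ k $ l) *
    (axis i 1 $ a * axis k 1 $ b * br (axis j 1) (axis l 1) $ c)"
      for i j k l
  have "schouten br r $ a $ b $ c =
      (\<Sum>i\<in>UNIV. \<Sum>j\<in>UNIV. \<Sum>k\<in>UNIV. \<Sum>l\<in>UNIV. F i j k l)
    + (\<Sum>i\<in>UNIV. \<Sum>j\<in>UNIV. \<Sum>k\<in>UNIV. \<Sum>l\<in>UNIV. G i j k l)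
    + (\<Sum>i\<in>UNIV. \<Sum>j\<in>UNIV. \<Sum>k\<in>UNIV. \<Sum>l\<in>UNIV. H i j k l)"
    by (simp add: schouten_def tensor3_def F_def G_def H_def distrib_left sum.distrib)
  also have "(\<Sum>i\<in>UNIV. \<Sum>j\<in>UNIV. \<Sum>k\<in>UNIV. \<Sum>l\<in>UNIV. F i j k l) =
      (\<Sum>i\<in>UNIV. \<Sum>k\<in>UNIV. \<Sum>j\<in>UNIV. \<Sum>l\<in>UNIV. F i j k l)"
    by (intro sum.cong refl sum.swap)
  also have "\<dots> = (\<Sum>i\<in>UNIV. \<Sum>k\<in>UNIV. r $ i $ b * r $ k $ c * br (axis i 1) (axis k 1) $ a)"
    by (intro sum.cong refl, subst sum_axis_tensor[symmetric]) (simp add: F_def mult_ac)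
  also have "(\<Sum>i\<in>UNIV. \<Sum>j\<in>UNIV. \<Sum>k\<in>UNIV. \<Sum>l\<in>UNIV. G i j k l) =
      (\<Sum>j\<in>UNIV. \<Sum>i\<in>UNIV. \<Sum>k\<in>UNIV. \<Sum>l\<in>UNIV. G i j k l)"
    by (rule sum.swap)
  also have "\<dots> = (\<Sum>j\<in>UNIV. \<Sum>k\<in>UNIV. \<Sum>i\<in>UNIV. \<Sum>l\<in>UNIV. G i j k l)"
    by (intro sum.cong refl sum.swap)
  also have "\<dots> = (\<Sum>j\<in>UNIV. \<Sum>k\<in>UNIV. r $ a $ j * r $ k $ c * br (axis j 1) (axis k 1) $ b)"
    by (intro sum.cong refl, subst sum_axis_tensor[symmetric]) (simp add: G_def mult_ac)
  also have "(\<Sum>i\<in>UNIV. \<Sum>j\<in>UNIV. \<Sum>k\<in>UNIV. \<Sum>l\<in>UNIV. H i j k l) =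
      (\<Sum>j\<in>UNIV. \<Sum>i\<in>UNIV. \<Sum>k\<in>UNIV. \<Sum>l\<in>UNIV. H i j k l)"
    by (rule sum.swap)
  also have "\<dots> = (\<Sum>j\<in>UNIV. \<Sum>i\<in>UNIV. \<Sum>l\<in>UNIV. \<Sum>k\<in>UNIV. H i j k l)"
    by (intro sum.cong refl sum.swap)
  also have "\<dots> = (\<Sum>j\<in>UNIV. \<Sum>l\<in>UNIV. \<Sum>i\<in>UNIV. \<Sum>k\<in>UNIV. H i j k l)"
    by (intro sum.cong refl sum.swap)
  also have "\<dots> = (\<Sum>j\<in>UNIV. \<Sum>l\<in>UNIV. r $ a $ j * r $ b $ l * br (axis j 1) (axis l 1) $ c)"
    by (intro sum.cong refl, subst sum_axis_tensor[symmetric]) (simp add: H_def mult_ac)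
  finally show ?thesis .
qed

section \<open>Coboundary structures on the Schroedinger algebra\<close>

lemma forall_gen: "(\<forall>x. P x) \<longleftrightarrow> P GenD \<and> P GenH \<and> P GenP \<and> P GenK \<and> P GenC \<and> P GenM"
  by (metis gen.exhaust)

lemma sum_gen:
  "(\<Sum>x\<in>UNIV. f x) = f GenD + f GenH + f GenP + f GenK + f GenC + f GenM"
  for f :: "gen \<Rightarrow> 'a::comm_monoid_add"
  by (simp add: UNIV_gen add.assoc)

lemma schr_bracket_nth:
  "schr_bracket X Y $ GenD = X $ GenH * Y $ GenC - X $ GenC * Y $ GenH"
  "schr_bracket X Y $ GenH = 2 * (X $ GenH * Y $ GenD - X $ GenD * Y $ GenH)"
  "schr_bracket X Y $ GenP =
    X $ GenP * Y $ GenD - X $ GenD * Y $ GenP + X $ GenK * Y $ GenH - X $ GenH * Y $ GenK"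
  "schr_bracket X Y $ GenK =
    X $ GenD * Y $ GenK - X $ GenK * Y $ GenD + X $ GenC * Y $ GenP - X $ GenP * Y $ GenC"
  "schr_bracket X Y $ GenC = 2 * (X $ GenD * Y $ GenC - X $ GenC * Y $ GenD)"
  "schr_bracket X Y $ GenM = X $ GenK * Y $ GenP - X $ GenP * Y $ GenK"
  by (simp_all add: schr_bracket_def sum_gen axis_def algebra_simps)

lemma lie_algebra_schr: "lie_algebra_on UNIV schr_bracket"
  by (simp add: lie_algebra_on_def linear_on_def vec_eq_iff forall_gen schr_bracket_nth)
    (simp add: algebra_simps)

lemma h4_eq: "h4 = coord_space {GenD, GenP, GenK, GenM}"
proof
  show "h4 \<subseteq> coord_space {GenD, GenP, GenK, GenM}"
    unfolding h4_def by (rule span_minimal) (auto simp: subspace_coord_space)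
  show "coord_space {GenD, GenP, GenK, GenM} \<subseteq> h4"
  proof
    fix x assume "x \<in> coord_space {GenD, GenP, GenK, GenM}"
    then have "x = (\<Sum>i\<in>{GenD, GenP, GenK, GenM}. x $ i *\<^sub>R axis i 1)"
      by (rule coord_space_expansion)
    also have "\<dots> \<in> h4"
      unfolding h4_def by (intro span_sum span_scale span_base) auto
    finally show "x \<in> h4" .
  qed
qed

lemma lie_algebra_h4: "lie_algebra_on h4 schr_bracket"
  using lie_algebra_schr subspace_coord_space[of "{GenD, GenP, GenK, GenM}"]
  unfolding lie_algebra_on_def h4_eq linear_on_def coord_space_def
  by (auto simp: forall_gen schr_bracket_nth)

section \<open>The six-parameter family of r-matrices\<close>

lemma r_schr_skew: "transpose (r_schr \<alpha>\<^sub>p \<alpha>\<^sub>m \<beta>\<^sub>p \<beta>\<^sub>m \<theta> \<xi>) = - r_schr \<alpha>\<^sub>p \<alpha>\<^sub>m \<beta>\<^sub>p \<beta>\<^sub>m \<theta> \<xi>"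
  by (simp add: vec_eq_iff transpose_def r_schr_def algebra_simps)

text \<open>The cocommutators of the theorem as a function of the generator, which is the form that
  \<open>co_jacobiator\<close> takes as its argument.\<close>

definition schr_cocommutator ::
  "real \<Rightarrow> real \<Rightarrow> real \<Rightarrow> real \<Rightarrow> real \<Rightarrow> real \<Rightarrow> gen \<Rightarrow> real ^ gen ^ gen" where
  "schr_cocommutator \<alpha>\<^sub>p \<alpha>\<^sub>m \<beta>\<^sub>p \<beta>\<^sub>m \<theta> \<xi> g = (case g of
     GenD \<Rightarrow> \<alpha>\<^sub>p *\<^sub>R \<D> \<^bold>\<and> \<P> - \<alpha>\<^sub>m *\<^sub>R \<D> \<^bold>\<and> \<K> - \<beta>\<^sub>p *\<^sub>R \<P> \<^bold>\<and> \<M> + \<beta>\<^sub>m *\<^sub>R \<K> \<^bold>\<and> \<M>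
   | GenP \<Rightarrow> \<alpha>\<^sub>m *\<^sub>R (\<D> \<^bold>\<and> \<M> - \<P> \<^bold>\<and> \<K>) - (\<theta> + \<xi>) *\<^sub>R \<P> \<^bold>\<and> \<M>
   | GenK \<Rightarrow> - \<alpha>\<^sub>p *\<^sub>R (\<D> \<^bold>\<and> \<M> + \<P> \<^bold>\<and> \<K>) + (\<theta> - \<xi>) *\<^sub>R \<K> \<^bold>\<and> \<M>
   | GenM \<Rightarrow> 0
   | GenH \<Rightarrow> (2 * \<alpha>\<^sub>p) *\<^sub>R \<P> \<^bold>\<and> \<H> + \<alpha>\<^sub>m *\<^sub>R (\<D> \<^bold>\<and> \<P> + 2 *\<^sub>R \<K> \<^bold>\<and> \<H>)
       - \<beta>\<^sub>m *\<^sub>R \<P> \<^bold>\<and> \<M> - (2 * \<theta>) *\<^sub>R \<H> \<^bold>\<and> \<M>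
   | GenC \<Rightarrow> - (2 * \<alpha>\<^sub>m) *\<^sub>R \<K> \<^bold>\<and> \<C> - \<alpha>\<^sub>p *\<^sub>R (\<D> \<^bold>\<and> \<K> + 2 *\<^sub>R \<P> \<^bold>\<and> \<C>)
       + \<beta>\<^sub>p *\<^sub>R \<K> \<^bold>\<and> \<M> + (2 * \<theta>) *\<^sub>R \<C> \<^bold>\<and> \<M>)"

lemma axis_gen_nth: "axis g (1::real) $ h = (if h = g then 1 else 0)"
  by (simp add: axis_def)

text \<open>An entrywise identity, linear in the six parameters; the quadratic constraints enter
  only with the co-Jacobi identity and the Schouten bracket.\<close>

lemma comm_left_r_schr:
  "comm_left schr_bracket (axis g 1) (r_schr \<alpha>\<^sub>p \<alpha>\<^sub>m \<beta>\<^sub>p \<beta>\<^sub>m \<theta> \<xi>) =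
     schr_cocommutator \<alpha>\<^sub>p \<alpha>\<^sub>m \<beta>\<^sub>p \<beta>\<^sub>m \<theta> \<xi> g"
  by (cases g)
    (simp_all add: vec_eq_iff forall_gen comm_left_nth sum_gen schr_bracket_nth r_schr_def
      schr_cocommutator_def axis_gen_nth)

text \<open>Turns the quadratic constraints into linear substitutions, after which the entrywise
  identities can be settled by simplification.\<close>

lemma admissible_cases:
  assumes "admissible \<alpha>\<^sub>p \<alpha>\<^sub>m \<theta> \<xi>"
  obtains "\<alpha>\<^sub>p = 0" "\<alpha>\<^sub>m = 0" | "\<alpha>\<^sub>m = 0" "\<xi> = - \<theta>" | "\<alpha>\<^sub>p = 0" "\<xi> = \<theta>"
  using assms by (fastforce simp: admissible_def)

lemma co_jacobiator_schr_cocommutator: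
  assumes "admissible \<alpha>\<^sub>p \<alpha>\<^sub>m \<theta> \<xi>"
  shows "co_jacobiator (schr_cocommutator \<alpha>\<^sub>p \<alpha>\<^sub>m \<beta>\<^sub>p \<beta>\<^sub>m \<theta> \<xi>) a i j l = 0"
proof -
  \<comment> \<open>The local constant keeps the cocommutators folded, so that \<open>table\<close>
    can act as a list of rewrite rules giving each entry its value.\<close>
  define c where "c = schr_cocommutator \<alpha>\<^sub>p \<alpha>\<^sub>m \<beta>\<^sub>p \<beta>\<^sub>m \<theta> \<xi>"
  have c: "\<forall>g i j. c g $ i $ j = schr_cocommutator \<alpha>\<^sub>p \<alpha>\<^sub>m \<beta>\<^sub>p \<beta>\<^sub>m \<theta> \<xi> g $ i $ j"
    by (simp add: c_def)
  note [simp] = axis_gen_nth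
  note table = c[unfolded schr_cocommutator_def forall_gen gen.case, simplified]
  have "\<forall>i j l. co_jacobiator c a i j l = 0"
    \<comment> \<open>In each case of the constraints and for each \<open>a\<close>, all triples of
      indices are enumerated. Zero entries are discarded first, which leaves short polynomial
      identities.\<close>
    using assms
    by (cases rule: admissible_cases; cases a;
      simp only: forall_gen co_jacobiator_def sum_gen table mult_zero_left mult_zero_right
        add_0 add_0_right minus_zero simp_thms;
      simp add: algebra_simps)
  then show ?thesis by (simp add: c_def)
qed

lemma r_schr_nth:
  "r_schr \<alpha>\<^sub>p \<alpha>\<^sub>m \<beta>\<^sub>p \<beta>\<^sub>m \<theta> \<xi> $ GenD $ GenP = - \<alpha>\<^sub>p" "r_schr \<alpha>\<^sub>p \<alpha>\<^sub>m \<beta>\<^sub>p \<beta>\<^sub>m \<theta> \<xi> $ GenP $ GenD = \<alpha>\<^sub>p"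
  "r_schr \<alpha>\<^sub>p \<alpha>\<^sub>m \<beta>\<^sub>p \<beta>\<^sub>m \<theta> \<xi> $ GenD $ GenK = - \<alpha>\<^sub>m" "r_schr \<alpha>\<^sub>p \<alpha>\<^sub>m \<beta>\<^sub>p \<beta>\<^sub>m \<theta> \<xi> $ GenK $ GenD = \<alpha>\<^sub>m"
  "r_schr \<alpha>\<^sub>p \<alpha>\<^sub>m \<beta>\<^sub>p \<beta>\<^sub>m \<theta> \<xi> $ GenP $ GenM = \<beta>\<^sub>p" "r_schr \<alpha>\<^sub>p \<alpha>\<^sub>m \<beta>\<^sub>p \<beta>\<^sub>m \<theta> \<xi> $ GenM $ GenP = - \<beta>\<^sub>p"
  "r_schr \<alpha>\<^sub>p \<alpha>\<^sub>m \<beta>\<^sub>p \<beta>\<^sub>m \<theta> \<xi> $ GenK $ GenM = \<beta>\<^sub>m" "r_schr \<alpha>\<^sub>p \<alpha>\<^sub>m \<beta>\<^sub>p \<beta>\<^sub>m \<theta> \<xi> $ GenM $ GenK = - \<beta>\<^sub>m"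
  "r_schr \<alpha>\<^sub>p \<alpha>\<^sub>m \<beta>\<^sub>p \<beta>\<^sub>m \<theta> \<xi> $ GenD $ GenM = - \<theta>" "r_schr \<alpha>\<^sub>p \<alpha>\<^sub>m \<beta>\<^sub>p \<beta>\<^sub>m \<theta> \<xi> $ GenM $ GenD = \<theta>"
  "r_schr \<alpha>\<^sub>p \<alpha>\<^sub>m \<beta>\<^sub>p \<beta>\<^sub>m \<theta> \<xi> $ GenP $ GenK = \<xi>" "r_schr \<alpha>\<^sub>p \<alpha>\<^sub>m \<beta>\<^sub>p \<beta>\<^sub>m \<theta> \<xi> $ GenK $ GenP = - \<xi>"
  "r_schr \<alpha>\<^sub>p \<alpha>\<^sub>m \<beta>\<^sub>p \<beta>\<^sub>m \<theta> \<xi> $ GenH $ g = 0" "r_schr \<alpha>\<^sub>p \<alpha>\<^sub>m \<beta>\<^sub>p \<beta>\<^sub>m \<theta> \<xi> $ g $ GenH = 0"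
  "r_schr \<alpha>\<^sub>p \<alpha>\<^sub>m \<beta>\<^sub>p \<beta>\<^sub>m \<theta> \<xi> $ GenC $ g = 0" "r_schr \<alpha>\<^sub>p \<alpha>\<^sub>m \<beta>\<^sub>p \<beta>\<^sub>m \<theta> \<xi> $ g $ GenC = 0"
  "r_schr \<alpha>\<^sub>p \<alpha>\<^sub>m \<beta>\<^sub>p \<beta>\<^sub>m \<theta> \<xi> $ g $ g = 0"
  by (cases g; simp add: r_schr_def axis_gen_nth)+

lemma schouten_r_schr:
  assumes "admissible \<alpha>\<^sub>p \<alpha>\<^sub>m \<theta> \<xi>"
  shows "schouten schr_bracket (r_schr \<alpha>\<^sub>p \<alpha>\<^sub>m \<beta>\<^sub>p \<beta>\<^sub>m \<theta> \<xi>) =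
    (\<alpha>\<^sub>p * \<beta>\<^sub>m + \<alpha>\<^sub>m * \<beta>\<^sub>p - \<xi>\<^sup>2) *\<^sub>R wedge3 \<K> \<M> \<P>" (is "?lhs = ?rhs")
proof -
  have "\<forall>a b c. ?lhs $ a $ b $ c = ?rhs $ a $ b $ c"
    using assms
    by (cases rule: admissible_cases;
      simp add: forall_gen schouten_nth sum_gen schr_bracket_nth r_schr_nth axis_gen_nth wedge3_def
        tensor3_def power2_eq_square)
  then show ?thesis by (simp add: vec_eq_iff)
qed

lemma schr_cocommutator_skew:
  "transpose (schr_cocommutator \<alpha>\<^sub>p \<alpha>\<^sub>m \<beta>\<^sub>p \<beta>\<^sub>m \<theta> \<xi> g) = - schr_cocommutator \<alpha>\<^sub>p \<alpha>\<^sub>m \<beta>\<^sub>p \<beta>\<^sub>m \<theta> \<xi> g"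
  unfolding comm_left_r_schr[symmetric] by (intro transpose_comm_left r_schr_skew)

lemma linear_on_comm_left_schr: "linear_on V (\<lambda>X. comm_left schr_bracket X t)"
  using linear_comm_left_arg[OF lie_algebra_schr] linear_on_subset
  by (fastforce simp flip: linear_on_UNIV)

lemma coboundary_schr_on_generators:
  assumes "coboundary schr_bracket (r_schr \<alpha>\<^sub>p \<alpha>\<^sub>m \<beta>\<^sub>p \<beta>\<^sub>m \<theta> \<xi>) \<delta>"
  shows "\<delta> (axis g 1) = schr_cocommutator \<alpha>\<^sub>p \<alpha>\<^sub>m \<beta>\<^sub>p \<beta>\<^sub>m \<theta> \<xi> g"
  using assms by (simp add: coboundary_def comm_left_r_schr)

text \<open>Formulated for a general coordinate subalgebra so as to serve both \<open>h4\<close> and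
  the whole algebra. The cocycle property is \<open>comm_left_bracket\<close>; the cocommutators of
  the generators in \<open>S\<close> must not leave the tensor square, which is the assumption
  \<open>supp\<close>.\<close>

lemma lie_bialgebra_coboundary_schr:
  fixes S :: "gen set"
  assumes "admissible \<alpha>\<^sub>p \<alpha>\<^sub>m \<theta> \<xi>"
    and \<delta>: "coboundary schr_bracket (r_schr \<alpha>\<^sub>p \<alpha>\<^sub>m \<beta>\<^sub>p \<beta>\<^sub>m \<theta> \<xi>) \<delta>"
    and S: "lie_algebra_on (coord_space S) schr_bracket"
    and supp: "\<And>g. g \<in> S \<Longrightarrow> schr_cocommutator \<alpha>\<^sub>p \<alpha>\<^sub>m \<beta>\<^sub>p \<beta>\<^sub>m \<theta> \<xi> g \<in> tensor_square (coord_space S)"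
  shows "lie_bialgebra schr_bracket (coord_space S) \<delta>"
    and "X \<in> coord_space S \<Longrightarrow> \<delta> X \<in> wedge_square (coord_space S)"
proof -
  let ?r = "r_schr \<alpha>\<^sub>p \<alpha>\<^sub>m \<beta>\<^sub>p \<beta>\<^sub>m \<theta> \<xi>"
  note gens = coboundary_schr_on_generators[OF \<delta>]
  have \<delta>_eq: "\<delta> = (\<lambda>X. comm_left schr_bracket X ?r)"
    using \<delta> by (auto simp: coboundary_def)
  have lin: "linear_on (coord_space S) \<delta>"
    unfolding \<delta>_eq by (rule linear_on_comm_left_schr)
  have \<delta>_supp: "\<delta> X \<in> tensor_square (coord_space S)" if "X \<in> coord_space S" for X
    unfolding linear_on_coord_space[OF lin that] gens
    using supp unfolding tensor_square_def by (intro span_sum span_scale)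
  show "lie_bialgebra schr_bracket (coord_space S) \<delta>"
  proof (rule lie_bialgebraI[OF lie_algebra_schr S lin \<delta>_supp])
    show "\<delta> (schr_bracket X Y) =
        comm_left schr_bracket X (\<delta> Y) - comm_left schr_bracket Y (\<delta> X)" for X Y
      unfolding \<delta>_eq by (rule comm_left_bracket[OF lie_algebra_schr])
  qed (simp_all add: gens schr_cocommutator_skew co_jacobiator_schr_cocommutator assms(1))
  show "\<delta> X \<in> wedge_square (coord_space S)" if "X \<in> coord_space S"
  proof (rule wedge_square_coord_space[OF _ \<delta>_supp[OF that]])
    show "transpose (\<delta> X) = - \<delta> X"
      unfolding \<delta>_eq by (intro transpose_comm_left r_schr_skew)
  qed
qed

lemma schr_cocommutator_h4:
  "g \<in> {GenD, GenP, GenK, GenM} \<Longrightarrow>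
    schr_cocommutator \<alpha>\<^sub>p \<alpha>\<^sub>m \<beta>\<^sub>p \<beta>\<^sub>m \<theta> \<xi> g \<in> tensor_square (coord_space {GenD, GenP, GenK, GenM})"
  by (auto simp: tensor_square_coord_space forall_gen schr_cocommutator_def axis_gen_nth)

lemma coboundary_schr_lie_sub_bialgebra:
  assumes "admissible \<alpha>\<^sub>p \<alpha>\<^sub>m \<theta> \<xi>"
    and "coboundary schr_bracket (r_schr \<alpha>\<^sub>p \<alpha>\<^sub>m \<beta>\<^sub>p \<beta>\<^sub>m \<theta> \<xi>) \<delta>"
  shows "lie_sub_bialgebra schr_bracket h4 \<delta> UNIV \<delta>"
proof -
  note lie_bialgebra_coboundary_schr[OF assms]
  note h4 = this[OF lie_algebra_h4[unfolded h4_eq] schr_cocommutator_h4]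
    and univ = this[of UNIV, unfolded coord_space_UNIV, OF lie_algebra_schr]
  show ?thesis
    unfolding lie_sub_bialgebra_def h4_eq
    using h4 univ by (simp add: tensor_square_coord_space[of _ UNIV, unfolded coord_space_UNIV])
qed

lemma lie_sub_bialgebra_cong:
  assumes "lie_sub_bialgebra br V \<delta>' W \<delta>" "lie_bialgebra br V \<delta>\<^sub>V" "\<And>X. X \<in> V \<Longrightarrow> \<delta> X = \<delta>\<^sub>V X"
  shows "lie_sub_bialgebra br V \<delta>\<^sub>V W \<delta>"
  using assms unfolding lie_sub_bialgebra_def by metis

lemma schr_bracket_gen:
  "schr_bracket \<D> \<P> = - \<P>" "schr_bracket \<D> \<K> = \<K>" "schr_bracket \<D> \<M> = 0"
  "schr_bracket \<P> \<K> = - \<M>" "schr_bracket \<P> \<M> = 0" "schr_bracket \<K> \<M> = 0"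
  "schr_bracket \<D> \<H> = - 2 *\<^sub>R \<H>" "schr_bracket \<D> \<C> = 2 *\<^sub>R \<C>"
  "schr_bracket \<P> \<H> = 0" "schr_bracket \<P> \<C> = - \<K>"
  "schr_bracket \<K> \<H> = \<P>" "schr_bracket \<K> \<C> = 0"
  by (simp_all add: vec_eq_iff forall_gen schr_bracket_nth axis_gen_nth)

section \<open>Classification\<close>

text \<open>Skewness and the support condition leave 24 unknowns, six tensor entries for each of
  four generators. The cocycle equations yield the 18 linear relations \<open>z\<close> among
  them.\<close>

lemma h4_bialgebra_classification:
  assumes \<delta>: "lie_bialgebra schr_bracket h4 \<delta>"
  obtains \<alpha>\<^sub>p \<alpha>\<^sub>m \<beta>\<^sub>p \<beta>\<^sub>m \<theta> \<xi> where "admissible \<alpha>\<^sub>p \<alpha>\<^sub>m \<theta> \<xi>"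
    and "\<And>X. X \<in> h4 \<Longrightarrow> \<delta> X = comm_left schr_bracket X (r_schr \<alpha>\<^sub>p \<alpha>\<^sub>m \<beta>\<^sub>p \<beta>\<^sub>m \<theta> \<xi>)"
proof -
  have \<delta>': "lie_bialgebra schr_bracket (coord_space {GenD, GenP, GenK, GenM}) \<delta>"
    using \<delta> by (simp add: h4_eq)
  define c where "c g i j = \<delta> (axis g 1) $ i $ j" for g i j
  have lin: "linear_on h4 \<delta>" using \<delta> by (simp add: lie_bialgebra_def)
  have in_h4: "\<D> \<in> h4" "\<P> \<in> h4" "\<K> \<in> h4" "\<M> \<in> h4"
    by (simp_all add: h4_eq)
  have \<delta>_neg: "\<delta> (- X) = - \<delta> X" if "X \<in> h4" for X
    using lin that unfolding linear_on_def by (metis scaleR_minus1_left)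
  have \<delta>_0: "\<delta> 0 = 0"
    using lin in_h4(1) unfolding linear_on_def by (metis scaleR_zero_left)
  have skew: "c g i j = - c g j i" if "g \<in> {GenD, GenP, GenK, GenM}" for g i j
    unfolding c_def by (rule skew_nth[OF lie_bialgebra_skew[OF \<delta>' that]])
  have diag: "c g i i = 0" if "g \<in> {GenD, GenP, GenK, GenM}" for g i
    using skew[OF that, of i i] by simp
  have supp: "c g i j = 0" if "g \<in> {GenD, GenP, GenK, GenM}" "i \<in> {GenH, GenC} \<or> j \<in> {GenH, GenC}" for g i j
    using \<delta>' that unfolding lie_bialgebra_def tensor_square_coord_space c_def by fastforce
  note coords = supp[of GenD] supp[of GenP] supp[of GenK] supp[of GenM]
    diag[of GenD] diag[of GenP] diag[of GenK] diag[of GenM]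
  \<comment> \<open>Skewness instantiated at fixed pairs orients every entry to the index order D,
    P, K, M, without looping in the simplifier.\<close>
  note flips = skew[of _ GenP GenD] skew[of _ GenK GenD] skew[of _ GenM GenD]
    skew[of _ GenK GenP] skew[of _ GenM GenP] skew[of _ GenM GenK]
  note expand = schr_bracket_gen \<delta>_neg \<delta>_0 in_h4 comm_left_nth sum_gen schr_bracket_nth axis_gen_nth
    c_def[symmetric] coords flips
  have DP: "\<delta> (schr_bracket \<D> \<P>) $ i $ j =
      (comm_left schr_bracket \<D> (\<delta> \<P>) - comm_left schr_bracket \<P> (\<delta> \<D>)) $ i $ j"
    and DK: "\<delta> (schr_bracket \<D> \<K>) $ i $ j =
      (comm_left schr_bracket \<D> (\<delta> \<K>) - comm_left schr_bracket \<K> (\<delta> \<D>)) $ i $ j"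
    and DM: "\<delta> (schr_bracket \<D> \<M>) $ i $ j =
      (comm_left schr_bracket \<D> (\<delta> \<M>) - comm_left schr_bracket \<M> (\<delta> \<D>)) $ i $ j"
    and PK: "\<delta> (schr_bracket \<P> \<K>) $ i $ j =
      (comm_left schr_bracket \<P> (\<delta> \<K>) - comm_left schr_bracket \<K> (\<delta> \<P>)) $ i $ j"
    and PM: "\<delta> (schr_bracket \<P> \<M>) $ i $ j =
      (comm_left schr_bracket \<P> (\<delta> \<M>) - comm_left schr_bracket \<M> (\<delta> \<P>)) $ i $ j"
    and KM: "\<delta> (schr_bracket \<K> \<M>) $ i $ j =
      (comm_left schr_bracket \<K> (\<delta> \<M>) - comm_left schr_bracket \<M> (\<delta> \<K>)) $ i $ j"
    for i j
    using lie_bialgebra_cocycle[OF \<delta>] in_h4 by simp_all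
  \<comment> \<open>The six entries of the cocycle equation for each of the six pairs of generators
    of \<open>h4\<close>.\<close>
  note eqs = DP[of GenD GenP] DP[of GenD GenK] DP[of GenD GenM] DP[of GenP GenK] DP[of GenP GenM] DP[of GenK GenM]
    DK[of GenD GenP] DK[of GenD GenK] DK[of GenD GenM] DK[of GenP GenK] DK[of GenP GenM] DK[of GenK GenM]
    DM[of GenD GenP] DM[of GenD GenK] DM[of GenD GenM] DM[of GenP GenK] DM[of GenP GenM] DM[of GenK GenM]
    PK[of GenD GenP] PK[of GenD GenK] PK[of GenD GenM] PK[of GenP GenK] PK[of GenP GenM] PK[of GenK GenM]
    PM[of GenD GenP] PM[of GenD GenK] PM[of GenD GenM] PM[of GenP GenK] PM[of GenP GenM] PM[of GenK GenM]
    KM[of GenD GenP] KM[of GenD GenK] KM[of GenD GenM] KM[of GenP GenK] KM[of GenP GenM] KM[of GenK GenM]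
  note [simp] = expand
  note eqs' = eqs[simplified]
  have z: "c GenD GenD GenM = 0" "c GenD GenP GenK = 0"
    "c GenP GenD GenP = 0" "c GenP GenD GenK = 0" "c GenP GenK GenM = 0"
    "c GenK GenD GenP = 0" "c GenK GenD GenK = 0" "c GenK GenP GenM = 0"
    "c GenM GenD GenP = 0" "c GenM GenD GenK = 0" "c GenM GenD GenM = 0"
    "c GenM GenP GenK = 0" "c GenM GenP GenM = 0" "c GenM GenK GenM = 0"
    "c GenD GenD GenK = c GenP GenP GenK" "c GenP GenD GenM = - c GenP GenP GenK"
    "c GenK GenP GenK = - c GenD GenD GenP" "c GenK GenD GenM = - c GenD GenD GenP"
    by (insert eqs') (linarith+)
  \<comment> \<open>The first four parameters are read off from \<delta>(D). The last two solve the
    equations \<open>- (\<theta> + \<xi>) = c GenP GenP GenM\<close> and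
    \<open>\<theta> - \<xi> = c GenK GenK GenM\<close>.\<close>
  let ?\<alpha>\<^sub>p = "c GenD GenD GenP" and ?\<alpha>\<^sub>m = "- c GenD GenD GenK"
    and ?\<beta>\<^sub>p = "- c GenD GenP GenM" and ?\<beta>\<^sub>m = "c GenD GenK GenM"
    and ?\<theta> = "(c GenK GenK GenM - c GenP GenP GenM) / 2"
    and ?\<xi> = "- (c GenK GenK GenM + c GenP GenP GenM) / 2"
  note co_jacobi = lie_bialgebra_co_jacobi[OF \<delta>', unfolded co_jacobiator_def]
  have "admissible ?\<alpha>\<^sub>p ?\<alpha>\<^sub>m ?\<theta> ?\<xi>"
    \<comment> \<open>In this order the three instances give
      \<open>\<alpha>\<^sub>p * \<alpha>\<^sub>m = 0\<close>,
      \<open>\<alpha>\<^sub>p * (\<xi> + \<theta>) = 0\<close> and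
      \<open>\<alpha>\<^sub>m * (\<xi> - \<theta>) = 0\<close>, up to nonzero factors.\<close>
    using co_jacobi[of GenP GenD GenP GenM] co_jacobi[of GenD GenD GenP GenM]
      co_jacobi[of GenD GenD GenK GenM]
    by (auto simp: z admissible_def field_simps)
  moreover have "\<delta> X = comm_left schr_bracket X (r_schr ?\<alpha>\<^sub>p ?\<alpha>\<^sub>m ?\<beta>\<^sub>p ?\<beta>\<^sub>m ?\<theta> ?\<xi>)" if "X \<in> h4" for X
    using that unfolding h4_eq
  proof (rule linear_on_eqI[OF lin[unfolded h4_eq] linear_on_comm_left_schr, rotated])
    fix g assume "g \<in> {GenD, GenP, GenK, GenM}"
    then show "\<delta> (axis g 1) = comm_left schr_bracket (axis g 1) (r_schr ?\<alpha>\<^sub>p ?\<alpha>\<^sub>m ?\<beta>\<^sub>p ?\<beta>\<^sub>m ?\<theta> ?\<xi>)"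
      unfolding comm_left_r_schr
      by (auto simp: vec_eq_iff forall_gen schr_cocommutator_def z field_simps)
  qed
  ultimately show ?thesis by (rule that)
qed

text \<open>To be applied to the difference of two extensions. For \<open>X\<close> in
  \<open>h4\<close> the term with \<open>\<epsilon> X\<close> drops out, so \<epsilon> sends the
  bracket of \<open>X\<close> with H to the action of \<open>X\<close> on \<epsilon>(H). Brackets of
  P and K with H or C stay in \<open>h4\<close>, hence P and K annihilate \<epsilon>(H) and
  \<epsilon>(C), while D fixes their weights.\<close>

lemma schr_cocycle_vanishing:
  assumes lin: "linear \<epsilon>"
    and cocycle: "\<And>X Y. \<epsilon> (schr_bracket X Y) =
      comm_left schr_bracket X (\<epsilon> Y) - comm_left schr_bracket Y (\<epsilon> X)"
    and skew: "\<And>X. transpose (\<epsilon> X) = - \<epsilon> X"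
    and zero: "\<And>X. X \<in> h4 \<Longrightarrow> \<epsilon> X = 0"
  shows "\<epsilon> X = 0"
proof -
  have zero_gens: "\<epsilon> \<D> = 0" "\<epsilon> \<P> = 0" "\<epsilon> \<K> = 0" "\<epsilon> \<M> = 0"
    by (simp_all add: zero h4_eq)
  have flips: "\<epsilon> X $ i $ j = - \<epsilon> X $ j $ i" for X i j
    by (rule skew_nth[OF skew])
  have diag: "\<epsilon> X $ i $ i = 0" for X i
    using flips[of X i i] by simp
  \<comment> \<open>Off the diagonal only these four index pairs have weight -2 or 2; the entries at
    P, P and K, K, of the same weights, vanish by \<open>diag\<close>.\<close>
  note flips' = flips[of _ GenH GenD] flips[of _ GenM GenH] flips[of _ GenC GenD] flips[of _ GenM GenC]
  note expand = schr_bracket_gen zero_gens linear_0[OF lin] linear_neg[OF lin] linear_scale[OF lin]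
    linear_0[OF linear_comm_left] comm_left_nth sum_gen schr_bracket_nth axis_gen_nth diag
  have "\<epsilon> \<H> = 0"
  proof -
    have "\<forall>i j. \<epsilon> (schr_bracket \<D> \<H>) $ i $ j =
        (comm_left schr_bracket \<D> (\<epsilon> \<H>) - comm_left schr_bracket \<H> (\<epsilon> \<D>)) $ i $ j"
      "\<forall>i j. \<epsilon> (schr_bracket \<P> \<H>) $ i $ j =
        (comm_left schr_bracket \<P> (\<epsilon> \<H>) - comm_left schr_bracket \<H> (\<epsilon> \<P>)) $ i $ j"
      "\<forall>i j. \<epsilon> (schr_bracket \<K> \<H>) $ i $ j =
        (comm_left schr_bracket \<K> (\<epsilon> \<H>) - comm_left schr_bracket \<H> (\<epsilon> \<K>)) $ i $ j"
      using cocycle by simp_all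
    then show ?thesis
      using flips'[of \<H>] by (auto simp: expand vec_eq_iff forall_gen)
  qed
  moreover have "\<epsilon> \<C> = 0"
  proof -
    have "\<forall>i j. \<epsilon> (schr_bracket \<D> \<C>) $ i $ j =
        (comm_left schr_bracket \<D> (\<epsilon> \<C>) - comm_left schr_bracket \<C> (\<epsilon> \<D>)) $ i $ j"
      "\<forall>i j. \<epsilon> (schr_bracket \<P> \<C>) $ i $ j =
        (comm_left schr_bracket \<P> (\<epsilon> \<C>) - comm_left schr_bracket \<C> (\<epsilon> \<P>)) $ i $ j"
      "\<forall>i j. \<epsilon> (schr_bracket \<K> \<C>) $ i $ j =
        (comm_left schr_bracket \<K> (\<epsilon> \<C>) - comm_left schr_bracket \<C> (\<epsilon> \<K>)) $ i $ j"
      using cocycle by simp_all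
    then show ?thesis
      using flips'[of \<C>] by (auto simp: expand vec_eq_iff forall_gen)
  qed
  ultimately have "\<epsilon> (axis g 1) = 0" for g
    using zero_gens by (cases g) simp_all
  then show ?thesis
    using linear_on_eqI[of UNIV \<epsilon> "\<lambda>_. 0"] lin
    by (simp add: linear_on_UNIV linear_zero)
qed

text \<open>The difference of \<open>\<delta>\<close> and the coboundary of \<open>r\<close> is a
  skew cocycle that is zero on \<open>h4\<close>, hence zero.\<close>

lemma schr_bialgebra_coboundary:
  assumes \<delta>: "lie_bialgebra schr_bracket UNIV \<delta>"
    and r: "transpose r = - r"
    and h4: "\<And>X. X \<in> h4 \<Longrightarrow> \<delta> X = comm_left schr_bracket X r"
  shows "coboundary schr_bracket r \<delta>"
proof -
  have lin: "linear \<delta>" "linear (\<lambda>X. comm_left schr_bracket X r)"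
    using \<delta> linear_on_comm_left_schr[of UNIV] by (simp_all add: lie_bialgebra_def linear_on_UNIV)
  have skew_gen: "transpose (\<delta> (axis g 1)) = - \<delta> (axis g 1)" for g
    by (rule lie_bialgebra_skew[of _ UNIV]) (use \<delta> in simp_all)
  have transpose_linear: "linear (transpose :: real ^ gen ^ gen \<Rightarrow> _)"
    by (rule linearI) (simp_all add: vec_eq_iff transpose_def)
  \<comment> \<open>Skewness is known on the generators from the dual bracket and extends to all of
    the algebra by linearity.\<close>
  have skew: "transpose (\<delta> X) = - \<delta> X" for X
    using linear_on_eqI[of UNIV "\<lambda>X. transpose (\<delta> X)" "\<lambda>X. - \<delta> X" X] skew_gen
      linear_compose[OF lin(1) transpose_linear] linear_compose_neg[OF lin(1)]
    by (simp add: linear_on_UNIV o_def)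
  have "\<delta> X - comm_left schr_bracket X r = 0" for X
  proof (rule schr_cocycle_vanishing)
    show "linear (\<lambda>X. \<delta> X - comm_left schr_bracket X r)"
      using lin by (rule linear_compose_sub)
    show "\<delta> (schr_bracket X Y) - comm_left schr_bracket (schr_bracket X Y) r =
        comm_left schr_bracket X (\<delta> Y - comm_left schr_bracket Y r)
        - comm_left schr_bracket Y (\<delta> X - comm_left schr_bracket X r)" for X Y
      using lie_bialgebra_cocycle[OF \<delta>, of X Y]
      by (simp add: comm_left_bracket[OF lie_algebra_schr] linear_diff[OF linear_comm_left])
    show "transpose (\<delta> X - comm_left schr_bracket X r) = - (\<delta> X - comm_left schr_bracket X r)" for X
      using skew[of X] transpose_comm_left[OF r, of schr_bracket X]
      by (simp add: linear_diff[OF transpose_linear])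
  qed (simp add: h4)
  then show ?thesis
    using r by (simp add: coboundary_def)
qed

theorem proposition4p1:
  shows
    "(\<forall>\<delta>\<^sub>h. lie_bialgebra schr_bracket h4 \<delta>\<^sub>h \<longrightarrow>
        (\<exists>\<delta>. lie_bialgebra schr_bracket UNIV \<delta> \<and> lie_sub_bialgebra schr_bracket h4 \<delta>\<^sub>h UNIV \<delta>)) \<and>
     (\<forall>\<delta>. (lie_bialgebra schr_bracket UNIV \<delta> \<and>
            (\<exists>\<delta>\<^sub>h. lie_sub_bialgebra schr_bracket h4 \<delta>\<^sub>h UNIV \<delta>)) \<longleftrightarrow>
          (\<exists>\<alpha>\<^sub>p \<alpha>\<^sub>m \<beta>\<^sub>p \<beta>\<^sub>m \<theta> \<xi>. admissible \<alpha>\<^sub>p \<alpha>\<^sub>m \<theta> \<xi> \<and>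
             coboundary schr_bracket (r_schr \<alpha>\<^sub>p \<alpha>\<^sub>m \<beta>\<^sub>p \<beta>\<^sub>m \<theta> \<xi>) \<delta>)) \<and>
     (\<forall>\<alpha>\<^sub>p \<alpha>\<^sub>m \<beta>\<^sub>p \<beta>\<^sub>m \<theta> \<xi>. admissible \<alpha>\<^sub>p \<alpha>\<^sub>m \<theta> \<xi> \<longrightarrow>
        (\<forall>\<delta>. coboundary schr_bracket (r_schr \<alpha>\<^sub>p \<alpha>\<^sub>m \<beta>\<^sub>p \<beta>\<^sub>m \<theta> \<xi>) \<delta> \<longrightarrow>
           \<delta> \<D> = \<alpha>\<^sub>p *\<^sub>R \<D> \<^bold>\<and> \<P> - \<alpha>\<^sub>m *\<^sub>R \<D> \<^bold>\<and> \<K> - \<beta>\<^sub>p *\<^sub>R \<P> \<^bold>\<and> \<M> + \<beta>\<^sub>m *\<^sub>R \<K> \<^bold>\<and> \<M> \<and>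
           \<delta> \<P> = \<alpha>\<^sub>m *\<^sub>R (\<D> \<^bold>\<and> \<M> - \<P> \<^bold>\<and> \<K>) - (\<theta> + \<xi>) *\<^sub>R \<P> \<^bold>\<and> \<M> \<and>
           \<delta> \<K> = - \<alpha>\<^sub>p *\<^sub>R (\<D> \<^bold>\<and> \<M> + \<P> \<^bold>\<and> \<K>) + (\<theta> - \<xi>) *\<^sub>R \<K> \<^bold>\<and> \<M> \<and>
           \<delta> \<M> = 0 \<and>
           \<delta> \<H> = (2 * \<alpha>\<^sub>p) *\<^sub>R \<P> \<^bold>\<and> \<H> + \<alpha>\<^sub>m *\<^sub>R (\<D> \<^bold>\<and> \<P> + 2 *\<^sub>R \<K> \<^bold>\<and> \<H>)
                 - \<beta>\<^sub>m *\<^sub>R \<P> \<^bold>\<and> \<M> - (2 * \<theta>) *\<^sub>R \<H> \<^bold>\<and> \<M> \<and>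
           \<delta> \<C> = - (2 * \<alpha>\<^sub>m) *\<^sub>R \<K> \<^bold>\<and> \<C> - \<alpha>\<^sub>p *\<^sub>R (\<D> \<^bold>\<and> \<K> + 2 *\<^sub>R \<P> \<^bold>\<and> \<C>)
                 + \<beta>\<^sub>p *\<^sub>R \<K> \<^bold>\<and> \<M> + (2 * \<theta>) *\<^sub>R \<C> \<^bold>\<and> \<M>) \<and>
        schouten schr_bracket (r_schr \<alpha>\<^sub>p \<alpha>\<^sub>m \<beta>\<^sub>p \<beta>\<^sub>m \<theta> \<xi>)
          = (\<alpha>\<^sub>p * \<beta>\<^sub>m + \<alpha>\<^sub>m * \<beta>\<^sub>p - \<xi>\<^sup>2) *\<^sub>R wedge3 \<K> \<M> \<P>)"
proof (intro conjI allI impI)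
  fix \<delta>\<^sub>h assume \<delta>\<^sub>h: "lie_bialgebra schr_bracket h4 \<delta>\<^sub>h"
  obtain \<alpha>\<^sub>p \<alpha>\<^sub>m \<beta>\<^sub>p \<beta>\<^sub>m \<theta> \<xi> where adm: "admissible \<alpha>\<^sub>p \<alpha>\<^sub>m \<theta> \<xi>"
    and eq: "\<And>X. X \<in> h4 \<Longrightarrow> \<delta>\<^sub>h X = comm_left schr_bracket X (r_schr \<alpha>\<^sub>p \<alpha>\<^sub>m \<beta>\<^sub>p \<beta>\<^sub>m \<theta> \<xi>)"
    using h4_bialgebra_classification[OF \<delta>\<^sub>h] by metis
  \<comment> \<open>The extension is the coboundary of the same r-matrix, now with the action of the
    whole algebra.\<close>
  define \<delta> where "\<delta> X = comm_left schr_bracket X (r_schr \<alpha>\<^sub>p \<alpha>\<^sub>m \<beta>\<^sub>p \<beta>\<^sub>m \<theta> \<xi>)" for X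
  have "coboundary schr_bracket (r_schr \<alpha>\<^sub>p \<alpha>\<^sub>m \<beta>\<^sub>p \<beta>\<^sub>m \<theta> \<xi>) \<delta>"
    by (simp add: coboundary_def \<delta>_def r_schr_skew)
  from coboundary_schr_lie_sub_bialgebra[OF adm this]
  have "lie_sub_bialgebra schr_bracket h4 \<delta>\<^sub>h UNIV \<delta>"
    by (rule lie_sub_bialgebra_cong[OF _ \<delta>\<^sub>h]) (simp add: \<delta>_def eq)
  then show "\<exists>\<delta>. lie_bialgebra schr_bracket UNIV \<delta> \<and> lie_sub_bialgebra schr_bracket h4 \<delta>\<^sub>h UNIV \<delta>"
    by (auto simp: lie_sub_bialgebra_def)
next
  fix \<delta>
  show "(lie_bialgebra schr_bracket UNIV \<delta> \<and>
      (\<exists>\<delta>\<^sub>h. lie_sub_bialgebra schr_bracket h4 \<delta>\<^sub>h UNIV \<delta>)) \<longleftrightarrow>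
    (\<exists>\<alpha>\<^sub>p \<alpha>\<^sub>m \<beta>\<^sub>p \<beta>\<^sub>m \<theta> \<xi>. admissible \<alpha>\<^sub>p \<alpha>\<^sub>m \<theta> \<xi> \<and>
      coboundary schr_bracket (r_schr \<alpha>\<^sub>p \<alpha>\<^sub>m \<beta>\<^sub>p \<beta>\<^sub>m \<theta> \<xi>) \<delta>)" (is "?L \<longleftrightarrow> ?R")
  proof
    assume ?L
    then obtain \<delta>\<^sub>h where \<delta>: "lie_bialgebra schr_bracket UNIV \<delta>"
      and \<delta>\<^sub>h: "lie_bialgebra schr_bracket h4 \<delta>\<^sub>h" "\<And>X. X \<in> h4 \<Longrightarrow> \<delta> X = \<delta>\<^sub>h X"
      by (auto simp: lie_sub_bialgebra_def)
    obtain \<alpha>\<^sub>p \<alpha>\<^sub>m \<beta>\<^sub>p \<beta>\<^sub>m \<theta> \<xi> where adm: "admissible \<alpha>\<^sub>p \<alpha>\<^sub>m \<theta> \<xi>"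
      and eq: "\<And>X. X \<in> h4 \<Longrightarrow> \<delta>\<^sub>h X = comm_left schr_bracket X (r_schr \<alpha>\<^sub>p \<alpha>\<^sub>m \<beta>\<^sub>p \<beta>\<^sub>m \<theta> \<xi>)"
      using h4_bialgebra_classification[OF \<delta>\<^sub>h(1)] by metis
    have "coboundary schr_bracket (r_schr \<alpha>\<^sub>p \<alpha>\<^sub>m \<beta>\<^sub>p \<beta>\<^sub>m \<theta> \<xi>) \<delta>"
      by (rule schr_bialgebra_coboundary[OF \<delta> r_schr_skew]) (simp add: \<delta>\<^sub>h(2) eq)
    with adm show ?R by blast
  next
    assume ?R
    then obtain \<alpha>\<^sub>p \<alpha>\<^sub>m \<beta>\<^sub>p \<beta>\<^sub>m \<theta> \<xi> where "admissible \<alpha>\<^sub>p \<alpha>\<^sub>m \<theta> \<xi>"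
      "coboundary schr_bracket (r_schr \<alpha>\<^sub>p \<alpha>\<^sub>m \<beta>\<^sub>p \<beta>\<^sub>m \<theta> \<xi>) \<delta>"
      by blast
    \<comment> \<open>The witness for the structure on \<open>h4\<close> is \<open>\<delta>\<close>
      itself, since only its values on \<open>h4\<close> matter there.\<close>
    then have "lie_sub_bialgebra schr_bracket h4 \<delta> UNIV \<delta>"
      by (rule coboundary_schr_lie_sub_bialgebra)
    then show ?L
      by (auto simp: lie_sub_bialgebra_def)
  qed
qed (simp_all add: coboundary_schr_on_generators schr_cocommutator_def schouten_r_schr)

end
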